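(* $\mathrm{Rel}(\textsc{Independent Set}, \mathrm{dist}_E, n^{\frac43})$ is in FP.
   Context: For a problem $\Pi$, a metric $\mathrm{dist}$ on its inputs, and a non-decreasing function $d:\mathbb N\to\mathbb R_+\cup\{\infty\}$, the function problem $\mathrm{Rel}(\Pi,\mathrm{dist},d)$ is: given an input $I$ of $\Pi$, output a pair $(J,\Pi(J))$ where $J$ is an input of $\Pi$ with $\mathrm{dist}(I,J)\le d(|I|)$ and $\Pi(J)$ is a correct answer to $\Pi$ on $J$ (a correct solution on $J$, or $\mathrm{nil}$ if none exists). For graph problems $|I|$ is the number of vertices $n$ of the input graph. For graphs $G,H$: $\mathrm{dist}_E(G,H)=|E(G)\triangle E(H)|$ if $V(G)=V(H)$ and $\infty$ otherwise; $\mathrm{dist}_E((G,k),(H,\ell))=\mathrm{dist}_E(G,H)$ if $k=\ell$ and $\infty$ otherwise. \textsc{Independent Set}: given a graph $G$ and a non-negative integer $k$, output an independent set of $G$ of size $k$, or $\mathrm{nil}$ if none exists. FP is the class of function problems solvable in polynomial time. *)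

theory Defs
  imports
    Complex_Main
    "HOL-Library.Extended_Nonnegative_Real"
    "HOL-Computational_Algebra.Polynomial"
begin

section \<open>Function problems and their relaxations\<close>

text \<open>
  \<open>correct P I\<close> is the set of all admissible outputs on the input \<open>I\<close>. For a search problem
  the outputs are of option type: \<open>Some S\<close> for a solution \<open>S\<close>, and \<open>None\<close> for \<open>nil\<close>.
\<close>

record ('i, 'o) function_problem =
  instances :: "'i set"
  correct :: "'i \<Rightarrow> 'o set"

definition search_problem :: "'i set \<Rightarrow> ('i \<Rightarrow> 's set) \<Rightarrow> ('i, 's option) function_problem" where
  "search_problem D sols =
     \<lparr> instances = D,
       correct = (\<lambda>I. if sols I = {} then {None} else Some ` sols I) \<rparr>"

definition Rel ::
  "('i \<Rightarrow> nat) \<Rightarrow> ('i, 'o) function_problem \<Rightarrow> ('i \<Rightarrow> 'i \<Rightarrow> ennreal) \<Rightarrow> (nat \<Rightarrow> ennreal)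
     \<Rightarrow> ('i, 'i \<times> 'o) function_problem" where
  "Rel sz P \<rho> d =
     \<lparr> instances = instances P,
       correct = (\<lambda>I. {(J, a). J \<in> instances P \<and> \<rho> I J \<le> d (sz I) \<and> a \<in> correct P J}) \<rparr>"


section \<open>Graphs and Independent Set\<close>

record 'v ugraph =
  verts :: "'v set"
  edges :: "'v set set"

definition simple_graph :: "'v ugraph \<Rightarrow> bool" where
  "simple_graph G \<longleftrightarrow> finite (verts G) \<and> (\<forall>e\<in>edges G. e \<subseteq> verts G \<and> card e = 2)"

definition independent :: "'v ugraph \<Rightarrow> 'v set \<Rightarrow> bool" where
  "independent G S \<longleftrightarrow> S \<subseteq> verts G \<and> (\<forall>u\<in>S. \<forall>v\<in>S. {u, v} \<notin> edges G)"

definition dist_E :: "'v ugraph \<Rightarrow> 'v ugraph \<Rightarrow> ennreal" where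
  "dist_E G H =
     (if verts G = verts H
      then of_nat (card ((edges G - edges H) \<union> (edges H - edges G))) else \<infinity>)"

definition dist_EK :: "'v ugraph \<times> nat \<Rightarrow> 'v ugraph \<times> nat \<Rightarrow> ennreal" where
  "dist_EK I J = (if snd I = snd J then dist_E (fst I) (fst J) else \<infinity>)"

definition vertex_count :: "'v ugraph \<times> nat \<Rightarrow> nat" where
  "vertex_count I = card (verts (fst I))"

text \<open>
  As usual for inputs that are strings, the vertices of an \<open>n\<close>-vertex input graph
  are named \<open>0, \<dots>, n - 1\<close>.
\<close>

definition independent_set_problem :: "(nat ugraph \<times> nat, nat set option) function_problem" where
  "independent_set_problem =
     search_problem {(G, k). simple_graph G \<and> (\<exists>n. verts G = {..<n})}
       (\<lambda>(G, k). {S. independent G S \<and> card S = k})"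


section \<open>Encodings as strings\<close>

datatype letter = Zero | One | Sep

text \<open>Binary representation, least significant bit first, without leading zeros.\<close>

fun enc_nat :: "nat \<Rightarrow> letter list" where
  "enc_nat n = (if n = 0 then [] else (if odd n then One else Zero) # enc_nat (n div 2))"

declare enc_nat.simps [simp del]

definition enc_vset :: "nat \<Rightarrow> nat set \<Rightarrow> letter list" where
  "enc_vset n S = map (\<lambda>v. if v \<in> S then One else Zero) [0..<n]"

text \<open>
  The rows of the adjacency matrix, each followed by a separator; then another separator,
  and the number \<open>k\<close> in binary.
\<close>

definition enc_graph :: "nat ugraph \<Rightarrow> letter list" where
  "enc_graph G =
     (let n = card (verts G)
      in concat (map (\<lambda>u. enc_vset n {v. {u, v} \<in> edges G} @ [Sep]) [0..<n]))"

definition enc_instance :: "nat ugraph \<times> nat \<Rightarrow> letter list" where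
  "enc_instance = (\<lambda>(G, k). enc_graph G @ [Sep] @ enc_nat k)"

definition enc_output :: "(nat ugraph \<times> nat) \<times> nat set option \<Rightarrow> letter list" where
  "enc_output = (\<lambda>(J, a).
     enc_instance J @ [Sep] @
       (case a of None \<Rightarrow> [Zero] | Some S \<Rightarrow> One # enc_vset (vertex_count J) S))"


section \<open>Multi-tape Turing machines and the class FP\<close>

text \<open>
  States are \<open>0, \<dots>, nstates - 1\<close> with initial state \<open>0\<close>; tape symbols are
  \<open>0, \<dots>, nsymbols - 1\<close>, where \<open>0\<close> is the blank and \<open>1, 2, 3\<close> are the letters of the input
  and output alphabet. The transition function maps a state and the list of symbols
  scanned on the tapes to a new state and, for each tape, the symbol to be written and the
  head movement; it is \<open>None\<close> if the machine halts.
\<close>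

datatype move = MoveLeft | Stay | MoveRight

record machine =
  ntapes :: nat
  nsymbols :: nat
  nstates :: nat
  delta :: "nat \<Rightarrow> nat list \<Rightarrow> (nat \<times> (nat \<times> move) list) option"

definition turing_machine :: "machine \<Rightarrow> bool" where
  "turing_machine M \<longleftrightarrow>
     1 \<le> ntapes M \<and> 4 \<le> nsymbols M \<and> 1 \<le> nstates M \<and>
     (\<forall>q ss q' acts.
        q < nstates M \<and> length ss = ntapes M \<and> set ss \<subseteq> {..<nsymbols M} \<and>
        delta M q ss = Some (q', acts)
        \<longrightarrow> q' < nstates M \<and> length acts = ntapes M \<and> fst ` set acts \<subseteq> {..<nsymbols M})"

text \<open>A tape consists of its contents (it is infinite in both directions) and the head position.\<close>

type_synonym tape = "(int \<Rightarrow> nat) \<times> int"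
type_synonym config = "nat \<times> tape list"

definition scan :: "tape \<Rightarrow> nat" where
  "scan t = fst t (snd t)"

fun move_head :: "move \<Rightarrow> int \<Rightarrow> int" where
  "move_head MoveLeft p = p - 1"
| "move_head Stay p = p"
| "move_head MoveRight p = p + 1"

definition act :: "nat \<times> move \<Rightarrow> tape \<Rightarrow> tape" where
  "act a t = ((fst t)(snd t := fst a), move_head (snd a) (snd t))"

definition next_action :: "machine \<Rightarrow> config \<Rightarrow> (nat \<times> (nat \<times> move) list) option" where
  "next_action M c = delta M (fst c) (map scan (snd c))"

definition step :: "machine \<Rightarrow> config \<Rightarrow> config" where
  "step M c = (case next_action M c of
      None \<Rightarrow> c
    | Some (q', acts) \<Rightarrow> (q', map2 act acts (snd c)))"

fun code :: "letter \<Rightarrow> nat" where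
  "code Zero = 1"
| "code One = 2"
| "code Sep = 3"

definition contents :: "letter list \<Rightarrow> int \<Rightarrow> nat" where
  "contents x i = (if 0 \<le> i \<and> nat i < length x then code (x ! nat i) else 0)"

text \<open>The input is on the first tape, all other tapes are blank.\<close>

definition init :: "machine \<Rightarrow> letter list \<Rightarrow> config" where
  "init M x = (0, (contents x, 0) # replicate (ntapes M - 1) (contents [], 0))"

text \<open>The output is read off the last tape, which must be blank otherwise.\<close>

definition outputs_within :: "machine \<Rightarrow> letter list \<Rightarrow> letter list \<Rightarrow> nat \<Rightarrow> bool" where
  "outputs_within M x y T \<longleftrightarrow>
     (\<exists>t\<le>T. let c = (step M ^^ t) (init M x)
            in next_action M c = None \<and> fst (last (snd c)) = contents y)"

text \<open>
  A function problem is in FP, relative to given encodings of its inputs and outputs, if some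
  Turing machine, given any input, produces one of the correct outputs in polynomial time.
\<close>

definition FP :: "('i \<Rightarrow> letter list) \<Rightarrow> ('o \<Rightarrow> letter list) \<Rightarrow> ('i, 'o) function_problem set" where
  "FP enc_in enc_out =
     {P. \<exists>M (p :: nat poly). turing_machine M \<and>
          (\<forall>I\<in>instances P. \<exists>a\<in>correct P I.
             outputs_within M (enc_in I) (enc_out a) (poly p (length (enc_in I))))}"


section \<open>The encodings are unambiguous\<close>

lemma enc_nat_0 [simp]: "enc_nat 0 = []"
  by (simp add: enc_nat.simps)

lemma enc_nat_inj: "enc_nat m = enc_nat n \<Longrightarrow> m = n"
proof (induction m arbitrary: n rule: less_induct)
  case (less m)
  show ?case
  proof (cases "m = 0 \<or> n = 0")
    case True
    then show ?thesis
      using less.prems by (auto simp: enc_nat.simps[of m] enc_nat.simps[of n] split: if_splits)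
  next
    case False
    then have "odd m = odd n" and "enc_nat (m div 2) = enc_nat (n div 2)"
      using less.prems by (auto simp: enc_nat.simps[of m] enc_nat.simps[of n] split: if_splits)
    moreover have "m div 2 < m"
      using False by simp
    ultimately have "odd m = odd n" "m div 2 = n div 2"
      using less.IH by blast+
    then show ?thesis
      by (metis even_two_times_div_two odd_two_times_div_two_succ)
  qed
qed

lemma Sep_notin_enc_nat: "Sep \<notin> set (enc_nat n)"
proof (induction n rule: less_induct)
  case (less n)
  then show ?case
    by (cases "n = 0") (auto simp: enc_nat.simps[of n])
qed

lemma Sep_notin_enc_vset: "Sep \<notin> set (enc_vset n S)"
  by (auto simp: enc_vset_def)

lemma length_enc_vset [simp]: "length (enc_vset n S) = n"
  by (simp add: enc_vset_def)

lemma enc_vset_inj: "enc_vset n S = enc_vset n S' \<Longrightarrow> v < n \<Longrightarrow> v \<in> S \<longleftrightarrow> v \<in> S'"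
  by (auto simp: enc_vset_def split: if_splits)

lemma append_Sep_inj:
  "\<lbrakk>Sep \<notin> set a; Sep \<notin> set b; a @ Sep # x = b @ Sep # y\<rbrakk> \<Longrightarrow> a = b \<and> x = y"
  by (induction a arbitrary: b) (auto simp: Cons_eq_append_conv append_eq_Cons_conv)

lemma rows_inj:
  assumes "\<forall>r\<in>set rs. Sep \<notin> set r \<and> r \<noteq> []" "\<forall>r\<in>set rs'. Sep \<notin> set r \<and> r \<noteq> []"
    and "concat (map (\<lambda>r. r @ [Sep]) rs) @ Sep # x = concat (map (\<lambda>r. r @ [Sep]) rs') @ Sep # y"
  shows "rs = rs' \<and> x = y"
  using assms
proof (induction rs arbitrary: rs')
  case Nil
  then show ?case
    by (cases rs') (auto simp: Cons_eq_append_conv)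
next
  case (Cons r rs)
  then obtain r' rs'' where rs': "rs' = r' # rs''"
    by (cases rs') (auto simp: append_eq_Cons_conv)
  have "r = r' \<and> concat (map (\<lambda>r. r @ [Sep]) rs) @ Sep # x
                 = concat (map (\<lambda>r. r @ [Sep]) rs'') @ Sep # y"
    using Cons.prems unfolding rs' by (intro append_Sep_inj) auto
  then show ?case
    using Cons.IH[of rs''] Cons.prems rs' by auto
qed

lemma enc_instance_append_inj:
  assumes "(G, k) \<in> instances independent_set_problem"
    and "(H, l) \<in> instances independent_set_problem"
    and eq: "enc_graph G @ Sep # x = enc_graph H @ Sep # y"
  shows "G = H \<and> x = y"
proof -
  obtain m n where GH: "simple_graph G" "simple_graph H" "verts G = {..<m}" "verts H = {..<n}"
    using assms by (auto simp: independent_set_problem_def search_problem_def)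
  define row where "row K j u = enc_vset j {v. {u, v} \<in> edges K}" for K :: "nat ugraph" and j u
  have enc: "enc_graph G = concat (map (\<lambda>r. r @ [Sep]) (map (row G m) [0..<m]))"
            "enc_graph H = concat (map (\<lambda>r. r @ [Sep]) (map (row H n) [0..<n]))"
    using GH by (simp_all add: enc_graph_def row_def comp_def)
  have ne: "\<forall>r\<in>set (map (row K j) [0..<j]). Sep \<notin> set r \<and> r \<noteq> []" for K j
    by (auto simp: row_def Sep_notin_enc_vset enc_vset_def)
  have rows: "map (row G m) [0..<m] = map (row H n) [0..<n]" and xy: "x = y"
    using rows_inj[OF ne ne] eq unfolding enc by blast+
  then have mn: "m = n"
    by (metis length_map length_upt diff_zero)
  have adj: "{u, v} \<in> edges G \<longleftrightarrow> {u, v} \<in> edges H" if "u < n" "v < n" for u v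
  proof -
    have "row G n u = row H n u"
      using rows mn that by auto
    then show ?thesis
      using enc_vset_inj[of n _ _ v] that unfolding row_def by blast
  qed
  have "e \<in> edges G \<longleftrightarrow> e \<in> edges H" for e
  proof (cases "\<exists>u v. e = {u, v} \<and> u < n \<and> v < n")
    case True
    then show ?thesis using adj by blast
  next
    case False
    then have "\<not> (e \<subseteq> {..<n} \<and> card e = 2)"
      by (auto simp: card_2_iff)
    then show ?thesis
      using GH mn unfolding simple_graph_def by metis
  qed
  then have "edges G = edges H" by blast
  then show ?thesis
    using GH mn xy by auto
qed

lemma inj_on_enc_instance: "inj_on enc_instance (instances independent_set_problem)"
proof (rule inj_onI, clarify)
  fix G k H l
  assume "(G, k) \<in> instances independent_set_problem" "(H, l) \<in> instances independent_set_problem"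
    and "enc_instance (G, k) = enc_instance (H, l)"
  then show "G = H \<and> k = l"
    using enc_instance_append_inj[of G k H l "enc_nat k" "enc_nat l"] enc_nat_inj
    by (auto simp: enc_instance_def)
qed

lemma inj_on_enc_output:
  "inj_on enc_output
     {(J, a). J \<in> instances independent_set_problem \<and> a \<in> correct independent_set_problem J}"
proof -
  have "((G, k), a) = ((H, l), b)"
    if I: "(G, k) \<in> instances independent_set_problem" "(H, l) \<in> instances independent_set_problem"
      and a: "a \<in> correct independent_set_problem (G, k)"
      and b: "b \<in> correct independent_set_problem (H, l)"
      and eq: "enc_output ((G, k), a) = enc_output ((H, l), b)"
    for G k a H l b
  proof -
    define tail where
      "tail K c = (case c of None \<Rightarrow> [Zero] | Some S \<Rightarrow> One # enc_vset (card (verts K)) S)"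
      for K :: "nat ugraph" and c
    have "enc_graph G @ Sep # (enc_nat k @ Sep # tail G a)
        = enc_graph H @ Sep # (enc_nat l @ Sep # tail H b)"
      using eq unfolding enc_output_def enc_instance_def vertex_count_def tail_def by (simp cong: option.case_cong)
    then have GH: "G = H" and "enc_nat k @ Sep # tail G a = enc_nat l @ Sep # tail H b"
      using enc_instance_append_inj[OF I] by blast+
    then have kl: "k = l" and t: "tail G a = tail G b"
      using append_Sep_inj[OF Sep_notin_enc_nat Sep_notin_enc_nat] enc_nat_inj by blast+
    have V: "verts G = {..<card (verts G)}"
      using I by (auto simp: independent_set_problem_def search_problem_def)
    have sub: "S \<subseteq> verts G" if "Some S \<in> {a, b}" for S
      using that a b GH
      by (auto simp: independent_set_problem_def search_problem_def independent_def split: if_splits)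
    have "a = b"
    proof (cases a; cases b)
      fix S S' assume ab: "a = Some S" "b = Some S'"
      then have "enc_vset (card (verts G)) S = enc_vset (card (verts G)) S'"
        using t by (simp add: tail_def)
      then have "v \<in> S \<longleftrightarrow> v \<in> S'" if "v \<in> verts G" for v
        using enc_vset_inj that V by blast
      then show "a = b"
        using sub ab by blast
    qed (use t in \<open>auto simp: tail_def\<close>)
    then show ?thesis
      using GH kl by simp
  qed
  then show ?thesis
    unfolding inj_on_def by fast
qed

end

theory Submission
  imports Defs
begin

text \<open>
  Put \<open>m = k - 1\<close>. If \<open>m\<^sup>3 < n\<^sup>2\<close>, then deleting the at most \<open>k (k - 1) / 2 \<le> m\<^sup>2\<close> edges inside
  \<open>{0, \<dots>, k - 1}\<close> makes this set a solution. Otherwise turn the residue classes modulo \<open>m\<close> into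
  cliques, which adds at most \<open>n \<cdot> \<lfloor>n / m\<rfloor>\<close> edges; no independent set contains two vertices of
  the same class, hence \<open>nil\<close> is a correct answer. Both numbers are at most \<open>n\<^bsup>4/3\<^esup>\<close>. As \<open>k\<close>
  may be exponentially large, the machine computes with \<open>min k (n + 1)\<close>, which leads to the same case
  and the same graph.

  The decision and each entry of the new adjacency matrix can be computed with a few counters bounded
  by a polynomial in \<open>n\<close>. A counter is a tape whose only nonblank cell is cell \<open>0\<close>, its value being
  the head position. It thus suffices to write a while-program over counters with a two-way
  read-only input and an append-only output.
\<close>

section \<open>Counter programs\<close>

datatype 'v test = Pos 'v | Read "nat set"

datatype 'v com =
    Inc 'v
  | Dec 'v
  | Move move
  | Out letter
  | Seq "'v com" "'v com" (infixr ";;" 60)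
  | Cond "'v test" "'v com" "'v com"
  | While "'v test" "'v com"

text \<open>Position of the input head, values of the counters, output written so far.\<close>

type_synonym 'v st = "int \<times> ('v \<Rightarrow> nat) \<times> letter list"

fun holds :: "letter list \<Rightarrow> 'v st \<Rightarrow> 'v test \<Rightarrow> bool" where
  "holds x (h, e, y) (Pos v) \<longleftrightarrow> e v \<noteq> 0"
| "holds x (h, e, y) (Read A) \<longleftrightarrow> contents x h \<in> A"

text \<open>
  A configuration is a stack of programs that remain to be executed, together with a state. Only
  finitely many stacks (\<open>conts\<close> below) are reachable; they are the states of the Turing machine.
\<close>

fun successor :: "('v test \<Rightarrow> bool) \<Rightarrow> 'v com list \<Rightarrow> 'v com list" where
  "successor \<sigma> [] = []"
| "successor \<sigma> ((c ;; d) # K) = c # d # K"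
| "successor \<sigma> (Cond b c d # K) = (if \<sigma> b then c else d) # K"
| "successor \<sigma> (While b c # K) = (if \<sigma> b then c # While b c # K else K)"
| "successor \<sigma> (_ # K) = K"

fun effect :: "'v com list \<Rightarrow> 'v st \<Rightarrow> 'v st" where
  "effect (Inc v # K) (h, e, y) = (h, e(v := Suc (e v)), y)"
| "effect (Dec v # K) (h, e, y) = (h, e(v := e v - 1), y)"
| "effect (Move d # K) (h, e, y) = (move_head d h, e, y)"
| "effect (Out a # K) (h, e, y) = (h, e, y @ [a])"
| "effect _ s = s"

definition sstep :: "letter list \<Rightarrow> 'v com list \<times> 'v st \<Rightarrow> 'v com list \<times> 'v st" where
  "sstep x = (\<lambda>(K, s). (successor (holds x s) K, effect K s))"

text \<open>The body of a loop gets the continuation \<open>While b c # K\<close>. The loop occurs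
  there only as an entry of the stack and is not expanded again, so the recursion is structural and
  the set finite.\<close>

fun conts :: "'v com \<Rightarrow> 'v com list \<Rightarrow> 'v com list set" where
  "conts (c ;; d) K = insert ((c ;; d) # K) (conts c (d # K) \<union> conts d K)"
| "conts (Cond b c d) K = insert (Cond b c d # K) (conts c K \<union> conts d K)"
| "conts (While b c) K = insert (While b c # K) (conts c (While b c # K))"
| "conts c K = {c # K}"

lemma finite_conts: "finite (conts c K)"
  by (induction c arbitrary: K) auto

lemma Cons_in_conts: "c # K \<in> conts c K"
  by (cases c) auto

text \<open>The extra \<open>K\<close> is the stack left behind once \<open>c\<close> is done. For
  the body of a loop this is the stack headed by the loop itself, which is already a member.\<close>

lemma successor_in_conts:
  "L \<in> conts c K \<Longrightarrow> successor \<sigma> L \<in> insert K (conts c K)"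
proof (induction c arbitrary: K)
  case (Seq c d)
  show ?case
    using Seq.prems Seq.IH(1)[of "d # K"] Seq.IH(2)[of K] Cons_in_conts[of c "d # K"] Cons_in_conts[of d K]
    by auto
next
  case (Cond b c d)
  show ?case
    using Cond.prems Cond.IH(1)[of K] Cond.IH(2)[of K] Cons_in_conts[of c K] Cons_in_conts[of d K]
    by auto
next
  case (While b c)
  show ?case
    using While.prems While.IH[of "While b c # K"] Cons_in_conts[of c "While b c # K"]
    by (auto split: if_splits)
qed auto

section \<open>Translation of counter programs into Turing machines\<close>

fun input_move :: "'v com list \<Rightarrow> move" where
  "input_move (Move d # K) = d"
| "input_move _ = Stay"

text \<open>The scanned symbol \<open>s\<close> is nonzero only on the marked cell \<open>0\<close>,
  that is, for a counter with value \<open>0\<close>. Not moving left there realises the truncated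
  subtraction in \<open>effect\<close>.\<close>

fun counter_move :: "'v com list \<Rightarrow> 'v \<Rightarrow> nat \<Rightarrow> move" where
  "counter_move (Inc w # K) v s = (if v = w then MoveRight else Stay)"
| "counter_move (Dec w # K) v s = (if v = w \<and> s = 0 then MoveLeft else Stay)"
| "counter_move _ v s = Stay"

fun output_act :: "'v com list \<Rightarrow> nat \<Rightarrow> nat \<times> move" where
  "output_act (Out a # K) s = (code a, MoveRight)"
| "output_act _ s = (s, Stay)"

definition com_acts :: "'v list \<Rightarrow> 'v com list \<Rightarrow> nat list \<Rightarrow> (nat \<times> move) list" where
  "com_acts vs K ss =
     (hd ss, input_move K) # map2 (\<lambda>v s. (s, counter_move K v s)) vs (butlast (tl ss))
       @ [output_act K (last ss)]"

fun sees :: "'v list \<Rightarrow> nat list \<Rightarrow> 'v test \<Rightarrow> bool" where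
  "sees vs ss (Pos v) \<longleftrightarrow> map_of (zip vs (butlast (tl ss))) v = Some 0"
| "sees vs ss (Read A) \<longleftrightarrow> hd ss \<in> A"

text \<open>\<open>None\<close> is the initial state of the machine, in which the cells \<open>0\<close> of the counters are marked.\<close>

fun com_delta :: "'v list \<Rightarrow> 'v com \<Rightarrow> 'v com list option \<Rightarrow> nat list
    \<Rightarrow> ('v com list option \<times> (nat \<times> move) list) option" where
  "com_delta vs c None ss =
     Some (Some [c], (hd ss, Stay) # map (\<lambda>v. (1, Stay)) vs @ [(last ss, Stay)])"
| "com_delta vs c (Some []) ss = None"
| "com_delta vs c (Some K) ss = Some (Some (successor (sees vs ss) K), com_acts vs K ss)"

text \<open>The output head rests on the blank cell behind the last letter, so that writing and
  moving right appends a letter.\<close>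

definition com_tapes :: "'v list \<Rightarrow> letter list \<Rightarrow> 'v st \<Rightarrow> tape list" where
  "com_tapes vs x = (\<lambda>(h, e, y). (contents x, h) # map (\<lambda>v. ((\<lambda>_. 0)(0 := 1), int (e v))) vs
      @ [(contents y, int (length y))])"

lemma scan_com_tapes:
  "map scan (com_tapes vs x (h, e, y)) =
     contents x h # map (\<lambda>v. if e v = 0 then 1 else 0) vs @ [0]"
  by (auto simp: com_tapes_def scan_def contents_def)

lemma sees_com_tapes:
  assumes "set vs = UNIV"
  shows "sees vs (map scan (com_tapes vs x s)) = holds x s"
proof
  fix b
  obtain h e y where s: "s = (h, e, y)" by (cases s)
  show "sees vs (map scan (com_tapes vs x s)) b = holds x s b"
    by (cases b) (simp_all add: s scan_com_tapes map_of_zip_map assms)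
qed

lemma map2_act_com_acts:
  "map2 act (com_acts vs K (map scan (com_tapes vs x s))) (com_tapes vs x s)
     = com_tapes vs x (effect K s)"
proof -
  obtain h e y where s: "s = (h, e, y)" by (cases s)
  have mid: "map2 act (map2 (\<lambda>v s. (s, counter_move K v s)) vs (map (\<lambda>v. if e v = 0 then 1 else 0) vs))
       (map (\<lambda>v. ((\<lambda>_. 0)(0 := 1), int (e v))) vs) =
      map (\<lambda>v. ((\<lambda>_. 0)(0 := 1), int (fst (snd (effect K s)) v))) vs"
  proof (rule nth_equalityI, simp, goal_cases)
    case (1 i)
    show ?case using 1 unfolding s
      by (cases "(K, vs ! i, if e (vs ! i) = 0 then 1 else 0 :: nat)" rule: counter_move.cases)
        (auto simp: act_def fun_eq_iff)
  qed
  have inp: "act (contents x h, input_move K) (contents x, h) = (contents x, fst (effect K s))"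
    unfolding s by (cases "(K, 0::nat)" rule: output_act.cases; cases K rule: input_move.cases) (auto simp: act_def)
  have out: "act (output_act K 0) (contents y, int (length y))
      = (contents (snd (snd (effect K s))), int (length (snd (snd (effect K s)))))"
    unfolding s
    by (cases "(K, 0::nat)" rule: output_act.cases)
      (auto simp: act_def fun_eq_iff contents_def nth_append)
  show ?thesis
    using mid inp out
    unfolding com_acts_def s scan_com_tapes by (simp add: com_tapes_def split: prod.splits)
qed

text \<open>One \<open>t\<close> must serve all continuations \<open>K\<close>; this lets runs be
  concatenated below an arbitrary stack. \<open>T\<close> is only an upper bound, so estimates may
  be rounded generously.\<close>

definition reaches :: "letter list \<Rightarrow> 'v com \<Rightarrow> 'v st \<Rightarrow> nat \<Rightarrow> 'v st \<Rightarrow> bool" where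
  "reaches x c s T s' \<longleftrightarrow> (\<exists>t\<le>T. \<forall>K. (sstep x ^^ t) (c # K, s) = (K, s'))"

lemma code_less: "code a < 4"
  by (cases a) auto

text \<open>The states are the stacks in \<open>conts c []\<close>, the empty stack, and one
  start-up state. Each later machine step simulates one \<open>sstep\<close>, and the machine halts
  on the empty stack. The start-up step accounts for \<open>Suc T\<close>. \<open>M\<close> is
  chosen before the input and the bound, as \<open>FP\<close> demands.\<close>

lemma outputs_within_com:
  fixes c :: "'v :: finite com"
  shows "\<exists>M. turing_machine M \<and>
    (\<forall>x T h e y. reaches x c (0, \<lambda>_. 0, []) T (h, e, y) \<longrightarrow> outputs_within M x y (Suc T))"
proof -
  \<comment> \<open>\<open>vs\<close> may list a counter repeatedly; its copies then move in step,
    so the first one found by \<open>map_of\<close> is representative.\<close>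
  obtain vs :: "'v list" where vs: "set vs = UNIV"
    using finite_list[OF finite_UNIV] by blast
  define S where "S = insert [] (conts c [])"
  have "finite S"
    by (simp add: S_def finite_conts)
  then obtain \<phi> where \<phi>: "bij_betw \<phi> S {0..<card S}"
    using ex_bij_betw_finite_nat by blast
  \<comment> \<open>\<open>init\<close> starts in state \<open>0\<close>, which is reserved for
    start-up; the stacks are numbered from \<open>1\<close>.\<close>
  define f where "f = case_option 0 (\<lambda>K. Suc (\<phi> K))"
  define g where "g = case_nat None (\<lambda>i. Some (inv_into S \<phi> i))"
  define M where "M = \<lparr>ntapes = length vs + 2, nsymbols = 4, nstates = Suc (card S),
     delta = (\<lambda>q ss. map_option (map_prod f id) (com_delta vs c (g q) ss))\<rparr>"
  have c_S: "[c] \<in> S"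
    by (simp add: S_def Cons_in_conts)
  have succ_S: "successor \<sigma> K \<in> S" if "K \<in> S" for \<sigma> K
    using that successor_in_conts[of K c "[]" \<sigma>] by (auto simp: S_def)
  have f_less: "f (Some K) < Suc (card S)" if "K \<in> S" for K
    using bij_betwE[OF \<phi>] that by (auto simp: f_def)
  have gf: "g (f (Some K)) = Some K" if "K \<in> S" for K
    using bij_betw_imp_inj_on[OF \<phi>] that by (simp add: g_def f_def)
  have g_S: "K \<in> S" if "g q = Some K" "q < Suc (card S)" for q K
    using that bij_betw_imp_surj_on[OF \<phi>]
    by (auto simp: g_def split: nat.splits intro!: inv_into_into)
  have "q' < nstates M \<and> length acts = ntapes M \<and> fst ` set acts \<subseteq> {..<nsymbols M}"
    if q: "q < nstates M" and len: "length ss = ntapes M" and ss: "set ss \<subseteq> {..<nsymbols M}"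
      and delta: "delta M q ss = Some (q', acts)" for q ss q' acts
  proof -
    obtain s0 sv sl where ss_eq: "ss = s0 # sv @ [sl]" and lsv: "length sv = length vs"
    proof -
      obtain s0 r where r: "ss = s0 # r" "length r = Suc (length vs)"
        using len by (cases ss) (auto simp: M_def)
      then show ?thesis
        using that[of s0 "butlast r" "last r"] by (cases r rule: rev_cases) auto
    qed
    have sym: "s0 < 4" "sl < 4" "set sv \<subseteq> {..<4}"
      using ss by (auto simp: ss_eq M_def)
    show ?thesis
    proof (cases "g q")
      case None
      then show ?thesis
        using delta f_less[OF c_S] sym by (auto simp: M_def ss_eq)
    next
      case (Some K)
      have K: "K \<in> S"
        using g_S Some q by (simp add: M_def)
      have "K \<noteq> []"
        using delta Some by (auto simp: M_def)
      then have q': "q' = f (Some (successor (sees vs ss) K))" and acts: "acts = com_acts vs K ss"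
        using delta Some by (cases K; auto simp: M_def)+
      have "fst (output_act K sl) < 4"
        using sym code_less
        by (cases "(K, sl)" rule: output_act.cases) auto
      moreover have "fst ` set (map2 (\<lambda>v s. (s, counter_move K v s)) vs sv) \<subseteq> {..<4}"
        using sym by (auto dest!: set_zip_rightD)
      ultimately show ?thesis
        using sym lsv f_less[OF succ_S[OF K]] unfolding q' acts
        by (simp add: M_def com_acts_def ss_eq image_Un)
    qed
  qed
  moreover have "1 \<le> ntapes M" "4 \<le> nsymbols M" "1 \<le> nstates M"
    by (simp_all add: M_def)
  ultimately have tm: "turing_machine M"
    unfolding turing_machine_def by blast
  have init_tapes: "init M x = (0, (contents x, 0) # replicate (length vs) (\<lambda>_. 0, 0) @ [(\<lambda>_. 0, 0)])" for x
    by (simp add: init_def M_def contents_def[abs_def] replicate_append_same)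
  have boot: "step M (init M x) = (f (Some [c]), com_tapes vs x (0, \<lambda>_. 0, []))" for x
  proof -
    have "map2 act (map (\<lambda>v. (1, Stay)) vs) (replicate (length vs) (\<lambda>_. 0, 0)) =
       map (\<lambda>v. ((\<lambda>_. 0)(0 := 1), 0)) vs"
      by (rule nth_equalityI) (auto simp: act_def)
    moreover have "contents [] = (\<lambda>_. 0)"
      by (auto simp: contents_def)
    moreover have "act (w 0, Stay) (w, 0) = (w, 0)" for w
      by (simp add: act_def)
    from this[of "contents x"] this[of "\<lambda>_. 0"]
    have "act (contents x 0, Stay) (contents x, 0) = (contents x, 0)"
      "act (0, Stay) (\<lambda>_. 0, 0) = (\<lambda>_. 0, 0)"
      by simp_all
    ultimately show ?thesis
      unfolding step_def next_action_def init_tapes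
      by (simp add: M_def g_def com_tapes_def scan_def)
  qed
  have next_act: "next_action M (f (Some K), com_tapes vs x s) =
      map_option (map_prod f id) (com_delta vs c (Some K) (map scan (com_tapes vs x s)))"
    if "K \<in> S" for K x s
    using gf[OF that] by (simp add: next_action_def M_def)
  have sim: "step M (f (Some K), com_tapes vs x s)
      = (f (Some (fst (sstep x (K, s)))), com_tapes vs x (snd (sstep x (K, s))))"
    if "K \<in> S" for K x s
  proof (cases K)
    case Nil
    then show ?thesis
      unfolding step_def next_act[OF that] by (simp add: sstep_def)
  next
    case (Cons d L)
    then show ?thesis
      unfolding step_def next_act[OF that]
      by (simp add: sstep_def sees_com_tapes[OF vs] map2_act_com_acts)
  qed
  have run: "fst ((sstep x ^^ t) ([c], s)) \<in> S \<and>
      (step M ^^ t) (f (Some [c]), com_tapes vs x s) =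
      (f (Some (fst ((sstep x ^^ t) ([c], s)))), com_tapes vs x (snd ((sstep x ^^ t) ([c], s))))" for x s t
  proof (induction t)
    case 0
    then show ?case using c_S by simp
  next
    case (Suc t)
    obtain K u where Ku: "(sstep x ^^ t) ([c], s) = (K, u)"
      by (cases "(sstep x ^^ t) ([c], s)")
    then show ?case
      using Suc sim[of K x u] succ_S[of K] by (simp add: sstep_def)
  qed
  have "outputs_within M x y (Suc T)" if r: "reaches x c (0, \<lambda>_. 0, []) T (h, e, y)" for x T h e y
  proof -
    obtain t where t: "t \<le> T" "(sstep x ^^ t) ([c], (0, \<lambda>_. 0, [])) = ([], (h, e, y))"
      using r by (auto simp: reaches_def)
    have fin: "(step M ^^ Suc t) (init M x) = (f (Some []), com_tapes vs x (h, e, y))"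
      using run[where x = x and t = t and s = "(0, \<lambda>_. 0, [])"] t(2)
      by (simp add: boot funpow_Suc_right del: funpow.simps)
    have "next_action M (f (Some []), com_tapes vs x (h, e, y)) = None"
      by (subst next_act) (auto simp: S_def)
    moreover have "fst (last (com_tapes vs x (h, e, y))) = contents y"
      by (simp add: com_tapes_def)
    ultimately show ?thesis
      unfolding outputs_within_def Let_def using t(1) fin
      by (intro exI[of _ "Suc t"]) simp
  qed
  with tm show ?thesis by blast
qed

section \<open>Rules for results and running times of programs\<close>

lemma reaches_weaken:
  "\<lbrakk>reaches x c s T s'; s' = s''; T \<le> T'\<rbrakk> \<Longrightarrow> reaches x c s T' s''"
  unfolding reaches_def by (meson order_trans)

lemma reaches_step:
  assumes "\<And>K. (sstep x ^^ t) (c # K, s) = (K, s')" shows "reaches x c s t s'"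
  using assms unfolding reaches_def by blast

lemma reaches_Inc: "reaches x (Inc v) (h, e, y) 1 (h, e(v := Suc (e v)), y)"
  by (rule reaches_step) (simp add: sstep_def)

lemma reaches_Dec: "reaches x (Dec v) (h, e, y) 1 (h, e(v := e v - 1), y)"
  by (rule reaches_step) (simp add: sstep_def)

lemma reaches_Move: "reaches x (Move d) (h, e, y) 1 (move_head d h, e, y)"
  by (rule reaches_step) (simp add: sstep_def)

lemma reaches_Out: "reaches x (Out a) (h, e, y) 1 (h, e, y @ [a])"
  by (rule reaches_step) (simp add: sstep_def)

lemma reaches_Seq:
  assumes "reaches x c s T s'" "reaches x d s' T' s''"
  shows "reaches x (c ;; d) s (Suc (T + T')) s''"
proof -
  obtain t t' where t: "t \<le> T" "\<And>K. (sstep x ^^ t) (c # K, s) = (K, s')"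
    and t': "t' \<le> T'" "\<And>K. (sstep x ^^ t') (d # K, s') = (K, s'')"
    using assms unfolding reaches_def by blast
  have "(sstep x ^^ (t' + (t + 1))) ((c ;; d) # K, s) = (K, s'')" for K
    using t t' by (simp only: funpow_add comp_apply) (simp add: sstep_def)
  then show ?thesis
    unfolding reaches_def using t(1) t'(1) by (intro exI[of _ "t' + (t + 1)"]) simp
qed

lemma reaches_Cond:
  assumes "reaches x (if holds x s b then c else d) s T s'"
  shows "reaches x (Cond b c d) s (Suc T) s'"
proof -
  obtain t where t: "t \<le> T" "\<And>K. (sstep x ^^ t) ((if holds x s b then c else d) # K, s) = (K, s')"
    using assms unfolding reaches_def by blast
  have "(sstep x ^^ (t + 1)) (Cond b c d # K, s) = (K, s')" for K
    using t by (simp only: funpow_add comp_apply) (simp add: sstep_def)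
  then show ?thesis
    unfolding reaches_def using t(1) by (intro exI[of _ "t + 1"]) simp
qed

lemma reaches_CondI:
  assumes "holds x s b \<Longrightarrow> reaches x c s T s'" "\<not> holds x s b \<Longrightarrow> reaches x d s T s'"
    and "Suc T \<le> T'"
  shows "reaches x (Cond b c d) s T' s'"
  using assms by (intro reaches_weaken[OF reaches_Cond[where T = T]]) auto

text \<open>The number of rounds and the whole sequence \<open>\<sigma>\<close> of intermediate
  states are supplied in closed form, which replaces an invariant and a termination measure. Each
  round costs one step for the test besides the body.\<close>

lemma reaches_While:
  assumes "\<And>i. i < n \<Longrightarrow> holds x (\<sigma> i) b \<and> reaches x c (\<sigma> i) T (\<sigma> (Suc i))"
    and "\<not> holds x (\<sigma> n) b"
  shows "reaches x (While b c) (\<sigma> 0) (n * Suc T + 1) (\<sigma> n)"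
  using assms
proof (induction n arbitrary: \<sigma>)
  case 0
  then show ?case by (intro reaches_step) (simp add: sstep_def)
next
  case (Suc n)
  have "reaches x (While b c) (\<sigma> (Suc 0)) (n * Suc T + 1) (\<sigma> (Suc n))"
    using Suc.IH[of "\<lambda>i. \<sigma> (Suc i)"] Suc.prems by auto
  then obtain t' where t': "t' \<le> n * Suc T + 1"
      "\<And>K. (sstep x ^^ t') (While b c # K, \<sigma> (Suc 0)) = (K, \<sigma> (Suc n))"
    unfolding reaches_def by blast
  obtain t where t: "t \<le> T" "\<And>K. (sstep x ^^ t) (c # K, \<sigma> 0) = (K, \<sigma> (Suc 0))"
    using Suc.prems(1)[of 0] unfolding reaches_def by blast
  have "(sstep x ^^ (t' + (t + 1))) (While b c # K, \<sigma> 0) = (K, \<sigma> (Suc n))" for K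
    using t t' Suc.prems(1)[of 0] by (simp only: funpow_add comp_apply) (simp add: sstep_def)
  then show ?case
    unfolding reaches_def using t(1) t'(1) by (intro exI[of _ "t' + (t + 1)"]) simp
qed

lemma reaches_WhileI:
  assumes "\<sigma> 0 = s" "\<sigma> n = s'"
    and "\<And>i. i < n \<Longrightarrow> holds x (\<sigma> i) b"
    and "\<And>i. i < n \<Longrightarrow> reaches x c (\<sigma> i) T (\<sigma> (Suc i))"
    and "\<not> holds x s' b" and "n * Suc T + 1 \<le> T'"
  shows "reaches x (While b c) s T' s'"
  using reaches_weaken[OF reaches_While[of n x \<sigma> b c T] refl] assms by auto

section \<open>Arithmetic on counters\<close>

definition skip :: "'v com" where "skip = Move Stay"

lemma reaches_skip: "reaches x skip s 1 s"
  unfolding skip_def by (cases s) (metis reaches_Move move_head.simps(2))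

definition clear :: "'v \<Rightarrow> 'v com" where
  "clear v = While (Pos v) (Dec v)"

lemma reaches_clear: "reaches x (clear v) (h, e, y) (2 * e v + 1) (h, e(v := 0), y)"
  unfolding clear_def
  by (rule reaches_WhileI[where \<sigma> = "\<lambda>i. (h, e(v := e v - i), y)" and n = "e v" and T = 1])
    (auto intro!: reaches_weaken[OF reaches_Dec])

text \<open>Executes \<open>c\<close> as often as \<open>a\<close> says; \<open>a\<close> is restored by means of \<open>t\<close>, which must be \<open>0\<close>.\<close>

definition times :: "'v \<Rightarrow> 'v \<Rightarrow> 'v com \<Rightarrow> 'v com" where
  "times t a c = While (Pos a) (Dec a ;; Inc t ;; c) ;; While (Pos t) (Dec t ;; Inc a)"

text \<open>The body runs while \<open>a\<close> is partly moved into \<open>t\<close>. Hence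
  \<open>E i\<close> describes the other counters after \<open>i\<close> rounds, and the current
  values of \<open>a\<close> and \<open>t\<close> are written over it.\<close>

lemma reaches_times:
  assumes "t \<noteq> a" "e t = 0" "E 0 = e"
    and c: "\<And>i. i < e a \<Longrightarrow> reaches x c (h, (E i)(a := e a - Suc i, t := Suc i), y) T
        (h, (E (Suc i))(a := e a - Suc i, t := Suc i), y)"
  shows "reaches x (times t a c) (h, e, y) (e a * (T + 10) + 10) (h, (E (e a))(a := e a, t := 0), y)"
proof -
  let ?n = "e a"
  have "reaches x (While (Pos a) (Dec a ;; Inc t ;; c)) (h, e, y) (?n * (T + 5) + 1)
          (h, (E ?n)(a := 0, t := ?n), y)"
  proof (rule reaches_WhileI[where \<sigma> = "\<lambda>i. (h, (E i)(a := ?n - i, t := i), y)" and n = ?n and T = "T + 4"])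
    fix i assume i: "i < ?n"
    let ?E = "(E i)(a := ?n - i, t := i)"
    have "?E(a := ?E a - 1, t := Suc ((?E(a := ?E a - 1)) t)) = (E i)(a := ?n - Suc i, t := Suc i)"
      using \<open>t \<noteq> a\<close> by (auto simp: fun_eq_iff)
    then show "reaches x (Dec a ;; Inc t ;; c) (h, ?E, y) (T + 4)
        (h, (E (Suc i))(a := ?n - Suc i, t := Suc i), y)"
      using c[OF i]
      by (intro reaches_weaken[OF reaches_Seq[OF reaches_Dec reaches_Seq[OF reaches_Inc]]])
        (simp only:, auto)
  qed (use assms in \<open>auto simp: fun_eq_iff\<close>)
  moreover have "reaches x (While (Pos t) (Dec t ;; Inc a)) (h, (E ?n)(a := 0, t := ?n), y) (?n * 4 + 1)
          (h, (E ?n)(a := ?n, t := 0), y)"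
  proof (rule reaches_WhileI[where \<sigma> = "\<lambda>i. (h, (E ?n)(a := i, t := ?n - i), y)" and n = ?n and T = 3])
    fix i assume "i < ?n"
    then show "reaches x (Dec t ;; Inc a) (h, (E ?n)(a := i, t := ?n - i), y) 3
        (h, (E ?n)(a := Suc i, t := ?n - Suc i), y)"
      using \<open>t \<noteq> a\<close>
      by (auto intro!: reaches_weaken[OF reaches_Seq[OF reaches_Dec reaches_Inc]] simp: fun_eq_iff)
  qed (use assms in auto)
  ultimately show ?thesis
    unfolding times_def by (rule reaches_weaken[OF reaches_Seq]) (auto simp: algebra_simps)
qed

definition add :: "'v \<Rightarrow> 'v \<Rightarrow> 'v \<Rightarrow> 'v com" where
  "add t a z = times t a (Inc z)"

lemma reaches_add:
  assumes "t \<noteq> a" "t \<noteq> z" "a \<noteq> z" "e t = 0"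
  shows "reaches x (add t a z) (h, e, y) (e a * 11 + 10) (h, e(z := e z + e a), y)"
  unfolding add_def
  by (rule reaches_weaken[OF reaches_times[where E = "\<lambda>i. e(z := e z + i)" and T = 1]])
    (use assms in \<open>auto intro!: reaches_weaken[OF reaches_Inc] simp: fun_eq_iff\<close>)

definition sub :: "'v \<Rightarrow> 'v \<Rightarrow> 'v \<Rightarrow> 'v com" where
  "sub t a z = times t a (Dec z)"

lemma reaches_sub:
  assumes "t \<noteq> a" "t \<noteq> z" "a \<noteq> z" "e t = 0"
  shows "reaches x (sub t a z) (h, e, y) (e a * 11 + 10) (h, e(z := e z - e a), y)"
  unfolding sub_def
  by (rule reaches_weaken[OF reaches_times[where E = "\<lambda>i. e(z := e z - i)" and T = 1]])
    (use assms in \<open>auto intro!: reaches_weaken[OF reaches_Dec] simp: fun_eq_iff\<close>)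

text \<open>Two scratch counters: \<open>t\<close> is in use while the inner addition runs, so the
  latter needs its own \<open>t'\<close>.\<close>

definition muladd :: "'v \<Rightarrow> 'v \<Rightarrow> 'v \<Rightarrow> 'v \<Rightarrow> 'v \<Rightarrow> 'v com" where
  "muladd t t' a b z = times t a (add t' b z)"

lemma reaches_muladd:
  assumes "distinct [t, t', a, b, z]" "e t = 0" "e t' = 0"
  shows "reaches x (muladd t t' a b z) (h, e, y) (e a * (e b * 11 + 20) + 10)
     (h, e(z := e z + e a * e b), y)"
  unfolding muladd_def
  by (rule reaches_weaken[OF reaches_times[where E = "\<lambda>i. e(z := e z + i * e b)" and T = "e b * 11 + 10"]])
    (use assms in \<open>auto intro!: reaches_weaken[OF reaches_add] simp: fun_eq_iff algebra_simps\<close>)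

section \<open>The program for the relaxed problem\<close>

datatype counter = Nv | Kv | Mv | Fv | Uv | Vv | Pv | Av | Bv | Dv | Tv | Sv

instance counter :: finite
proof
  have "UNIV = {Nv, Kv, Mv, Fv, Uv, Vv, Pv, Av, Bv, Dv, Tv, Sv}"
    using counter.exhaust by auto
  then show "finite (UNIV :: counter set)"
    by (metis finite.emptyI finite.insertI)
qed

text \<open>One step of the Horner scheme for \<open>min k (n + 1)\<close>, reading the bits of \<open>k\<close> from the most significant one.\<close>

definition digit :: "counter com" where
  "digit =
     While (Pos Kv) (Dec Kv ;; Inc Dv ;; Inc Dv) ;;
     Cond (Read {2}) (Inc Dv) skip ;;
     (add Tv Nv Av ;; Inc Av) ;;
     While (Pos Dv) (Dec Dv ;; Cond (Pos Av) (Dec Av ;; Inc Kv) skip) ;;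
     clear Av"

text \<open>The doubled value plus the new bit is collected in \<open>Dv\<close>. It flows back into
  \<open>Kv\<close> only as long as \<open>Av\<close>, which starts at \<open>n + 1\<close>, is
  positive; this imposes the cap.\<close>

lemma reaches_digit:
  assumes z: "e Tv = 0" "e Av = 0" "e Dv = 0"
    and b_def: "b = (if contents x h = 2 then 1 else 0)"
  shows "reaches x digit (h, e, y) (100 * (e Kv + e Nv) + 100)
     (h, e(Kv := min (2 * e Kv + b) (Suc (e Nv))), y)"
proof -
  let ?d = "2 * e Kv + b" and ?a = "Suc (e Nv)"
  have 1: "reaches x (While (Pos Kv) (Dec Kv ;; Inc Dv ;; Inc Dv)) (h, e, y) (e Kv * 6 + 1)
      (h, e(Kv := 0, Dv := 2 * e Kv), y)"
  proof (rule reaches_WhileI[where \<sigma> = "\<lambda>i. (h, e(Kv := e Kv - i, Dv := 2 * i), y)" and n = "e Kv" and T = 5])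
    fix i assume "i < e Kv"
    show "reaches x (Dec Kv ;; Inc Dv ;; Inc Dv) (h, e(Kv := e Kv - i, Dv := 2 * i), y) 5
        (h, e(Kv := e Kv - Suc i, Dv := 2 * Suc i), y)"
      by (rule reaches_weaken, (rule reaches_Seq reaches_Dec reaches_Inc)+) (auto simp: fun_eq_iff)
  qed (use z in \<open>auto simp: fun_eq_iff\<close>)
  have 2: "reaches x (Cond (Read {2}) (Inc Dv) skip) (h, e(Kv := 0, Dv := 2 * e Kv), y) 2
      (h, e(Kv := 0, Dv := ?d), y)"
    by (rule reaches_CondI[where T = 1])
      (auto simp: b_def fun_eq_iff intro!: reaches_weaken[OF reaches_Inc] reaches_weaken[OF reaches_skip])
  have 3: "reaches x (While (Pos Dv) (Dec Dv ;; Cond (Pos Av) (Dec Av ;; Inc Kv) skip))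
      (h, e(Kv := 0, Dv := ?d, Av := ?a), y) (?d * 7 + 1) (h, e(Kv := min ?d ?a, Dv := 0, Av := ?a - ?d), y)"
  proof (rule reaches_WhileI[where \<sigma> = "\<lambda>i. (h, e(Kv := min i ?a, Dv := ?d - i, Av := ?a - i), y)" and n = ?d and T = 6])
    fix i assume "i < ?d"
    show "reaches x (Dec Dv ;; Cond (Pos Av) (Dec Av ;; Inc Kv) skip)
        (h, e(Kv := min i ?a, Dv := ?d - i, Av := ?a - i), y) 6
        (h, e(Kv := min (Suc i) ?a, Dv := ?d - Suc i, Av := ?a - Suc i), y)"
      by (rule reaches_weaken, rule reaches_Seq[OF reaches_Dec], rule reaches_CondI[where T = 3])
        (auto simp: fun_eq_iff intro!: reaches_weaken[OF reaches_Seq[OF reaches_Dec reaches_Inc]]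
          reaches_weaken[OF reaches_skip])
  qed (use z in \<open>auto simp: fun_eq_iff\<close>)
  have 4: "reaches x (add Tv Nv Av ;; Inc Av) (h, e(Kv := 0, Dv := ?d), y) (11 * e Nv + 12)
      (h, e(Kv := 0, Dv := ?d, Av := ?a), y)"
    by (rule reaches_weaken, (rule reaches_Seq reaches_add reaches_Inc | simp add: z; fail)+)
  show ?thesis
    unfolding digit_def
    by (rule reaches_weaken, rule reaches_Seq[OF 1 reaches_Seq[OF 2 reaches_Seq[OF 4 reaches_Seq[OF 3 reaches_clear]]]])
      (use z b_def in \<open>auto simp: fun_eq_iff\<close>)
qed


text \<open>\<open>Fv\<close> becomes positive iff the deletion case applies, \<open>k = 0\<close> included.\<close>

definition decide :: "counter com" where
  "decide =
     (add Tv Kv Mv ;; Dec Mv) ;;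
     add Tv Mv Dv ;; muladd Tv Sv Dv Mv Av ;; muladd Tv Sv Dv Av Pv ;;
     add Tv Nv Bv ;; muladd Tv Sv Bv Nv Fv ;; sub Tv Pv Fv ;;
     clear Av ;; clear Bv ;; clear Dv ;; clear Pv ;;
     Cond (Pos Kv) skip (Inc Fv)"

text \<open>Positive iff \<open>(k - 1) ^ 3 < n ^ 2\<close> or \<open>k = 0\<close>, as the
  subtraction is truncated. The last summand changes the sign only for \<open>n = k = 0\<close>,
  where the empty set forbids the answer \<open>nil\<close>.\<close>

definition decision :: "nat \<Rightarrow> nat \<Rightarrow> nat" where
  "decision n k = n * n - (k - 1) * ((k - 1) * (k - 1)) + (if k = 0 then 1 else 0)"

text \<open>All products are formed by unary counting. The cap \<open>k \<le> Suc n\<close> keeps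
  \<open>m * m * m\<close> below \<open>n * n * n\<close> and thus gives the cubic time
  bound.\<close>

lemma reaches_decide:
  assumes "k \<le> Suc n"
  shows "reaches x decide (h, (\<lambda>_. 0)(Nv := n, Kv := k), y) (1000 * (n + 1) ^ 3)
     (h, (\<lambda>_. 0)(Nv := n, Kv := k, Mv := k - 1, Fv := decision n k), y)"
proof -
  define m where "m = k - 1"
  have m: "m \<le> n" using assms by (simp add: m_def)
  have mm: "m * m \<le> n * n" "m * (m * m) \<le> n * (n * n)"
    using m by (auto intro!: mult_le_mono)
  let ?e = "(\<lambda>_. 0)(Nv := n, Kv := k)"
  let ?f = "(\<lambda>_. 0)(Nv := n, Kv := k, Mv := m)"
  have 1: "reaches x (add Tv Kv Mv ;; Dec Mv) (h, ?e, y) (11 * k + 12) (h, ?f, y)"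
    by (rule reaches_weaken, (rule reaches_Seq reaches_add reaches_Dec | simp; fail)+)
      (auto simp: fun_eq_iff m_def)
  show ?thesis
    unfolding decide_def
    apply (rule reaches_weaken, rule reaches_Seq[OF 1])
      apply (rule reaches_Seq, (rule reaches_add reaches_muladd reaches_sub reaches_clear; (simp; fail)), (simp)?)+
      apply (rule reaches_CondI[where T = 1 and T' = 2 and s' = "(h, (\<lambda>_. 0)(Nv := n, Kv := k, Mv := k - 1, Fv := decision n k), y)"])
        apply (auto intro!: reaches_weaken[OF reaches_skip] reaches_weaken[OF reaches_Inc] simp: fun_eq_iff m_def decision_def)[3]
     apply (rule refl)
    using mm m assms
    apply (simp add: algebra_simps power3_eq_cube)
    done
qed

section \<open>Computing single entries of the new matrix\<close>

definition copy :: "counter com" where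
  "copy = Cond (Read {1}) (Out Zero) (Out One)"

lemma reaches_copy:
  assumes "contents x h = code l" "l \<noteq> Sep"
  shows "reaches x copy (h, e, y) 2 (h, e, y @ [l])"
  unfolding copy_def
  by (rule reaches_CondI[where T = 1])
    (use assms in \<open>cases l; auto intro!: reaches_weaken[OF reaches_Out]\<close>)+

definition emit_small :: "counter com" where
  "emit_small =
     add Tv Kv Av ;; sub Tv Uv Av ;; add Tv Kv Bv ;; sub Tv Vv Bv ;;
     Cond (Pos Av) (Cond (Pos Bv) (Out Zero) copy) copy ;;
     clear Av ;; clear Bv"

text \<open>Comparisons become tests for positivity: the truncated differences \<open>k - u\<close>
  and \<open>k - v\<close> are both nonzero exactly for a pair inside \<open>{..<k}\<close>.\<close>

lemma reaches_emit_small: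
  assumes z: "e Tv = 0" "e Av = 0" "e Bv = 0"
    and l: "contents x h = code l" "l \<noteq> Sep"
  shows "reaches x emit_small (h, e, y) (100 * (e Kv + e Uv + e Vv) + 100)
     (h, e, y @ [if e Uv < e Kv \<and> e Vv < e Kv then Zero else l])"
proof -
  let ?e = "e(Av := e Kv - e Uv, Bv := e Kv - e Vv)"
  have 1: "reaches x (Cond (Pos Av) (Cond (Pos Bv) (Out Zero) copy) copy) (h, ?e, y) 5
      (h, ?e, y @ [if e Uv < e Kv \<and> e Vv < e Kv then Zero else l])"
    using l
    by (intro reaches_CondI[where T = 3] reaches_CondI[where T = 2])
      (auto intro!: reaches_weaken[OF reaches_copy[OF l]] reaches_weaken[OF reaches_Out])
  show ?thesis
    unfolding emit_small_def
    apply (rule reaches_weaken)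
      apply (rule reaches_Seq, (rule reaches_add reaches_sub; (simp add: z; fail)), (simp add: z)?)+
      apply (rule reaches_Seq)
      apply (rule 1)
      apply (rule reaches_Seq[OF reaches_clear reaches_clear])
    using z apply (auto simp: fun_eq_iff)
    done
qed

definition residue :: "counter com" where
  "residue =
     While (Pos Dv) (Dec Dv ;; Inc Bv ;; add Tv Mv Av ;; sub Tv Bv Av ;;
       Cond (Pos Av) skip (clear Bv) ;; clear Av)"

text \<open>\<open>Bv\<close> counts up while \<open>Dv\<close> counts down. After each increment
  the truncated difference of \<open>Mv\<close> and \<open>Bv\<close> vanishes exactly when
  \<open>Bv\<close> has reached the modulus, and then \<open>Bv\<close> is reset.\<close>

lemma reaches_residue:
  assumes z: "e Tv = 0" "e Av = 0" "e Bv = 0" and m: "e Mv > 0"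
  shows "reaches x residue (h, e, y) (e Dv * (100 * e Mv + 100) + 1)
     (h, e(Dv := 0, Bv := e Dv mod e Mv), y)"
  unfolding residue_def
proof (rule reaches_WhileI[where \<sigma> = "\<lambda>i. (h, e(Dv := e Dv - i, Bv := i mod e Mv), y)"
      and n = "e Dv" and T = "100 * e Mv + 99"])
  fix i assume "i < e Dv"
  define b where "b = i mod e Mv"
  have b: "b < e Mv" using m by (simp add: b_def)
  let ?e = "e(Dv := e Dv - Suc i, Bv := Suc b, Av := e Mv - Suc b)"
  have 1: "reaches x (Cond (Pos Av) skip (clear Bv)) (h, ?e, y) (2 * e Mv + 2)
      (h, ?e(Bv := Suc i mod e Mv), y)"
    by (rule reaches_CondI[where T = "2 * e Mv + 1"])
      (use b in \<open>auto simp: fun_eq_iff b_def mod_Suc intro!: reaches_weaken[OF reaches_skip] reaches_weaken[OF reaches_clear]\<close>)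
  show "reaches x (Dec Dv ;; Inc Bv ;; add Tv Mv Av ;; sub Tv Bv Av ;;
       Cond (Pos Av) skip (clear Bv) ;; clear Av)
      (h, e(Dv := e Dv - i, Bv := i mod e Mv), y) (100 * e Mv + 99)
      (h, e(Dv := e Dv - Suc i, Bv := Suc i mod e Mv), y)"
    apply (rule reaches_weaken)
      apply (rule reaches_Seq, (rule reaches_Dec reaches_Inc reaches_add reaches_sub; (simp add: z; fail)), (simp add: z)?)+
      apply (rule reaches_Seq)
      apply (rule 1[unfolded b_def])
      apply (rule reaches_clear)
    using z b[unfolded b_def] apply (auto simp: fun_eq_iff)
    done
qed (use z in \<open>auto simp: fun_eq_iff\<close>)

definition emit_large :: "counter com" where
  "emit_large =
     add Tv Uv Dv ;; sub Tv Vv Dv ;; add Tv Vv Av ;; sub Tv Uv Av ;; add Tv Av Dv ;; clear Av ;;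
     Cond (Pos Dv) (residue ;; Cond (Pos Bv) copy (Out One) ;; clear Bv) copy"

text \<open>One of the two truncated differences is zero, so their sum is the absolute difference.
  Equality of residues thus needs a single remainder computation.\<close>

lemma dvd_dist_iff_mod_eq: "m dvd (u - v) + (v - u) \<longleftrightarrow> u mod m = v mod m" for m u v :: nat
proof (cases u v rule: le_cases)
  case le
  then show ?thesis using mod_eq_dvd_iff_nat[of u v m] by auto
next
  case ge
  then show ?thesis using mod_eq_dvd_iff_nat[of v u m] by auto
qed

text \<open>\<open>Dv\<close> receives the absolute difference of \<open>u\<close> and
  \<open>v\<close>. If it is zero, the entry is diagonal and copied; otherwise its remainder modulo
  \<open>m\<close> decides whether both vertices share a class.\<close>

lemma reaches_emit_large:
  assumes z: "e Tv = 0" "e Av = 0" "e Bv = 0" "e Dv = 0" and m: "e Mv > 0"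
    and l: "contents x h = code l" "l \<noteq> Sep"
  shows "reaches x emit_large (h, e, y) ((e Uv + e Vv + 1) * (200 * e Mv + 300))
     (h, e, y @ [if e Uv \<noteq> e Vv \<and> e Uv mod e Mv = e Vv mod e Mv then One else l])"
proof -
  let ?d = "(e Uv - e Vv) + (e Vv - e Uv)"
  let ?y = "y @ [if e Uv \<noteq> e Vv \<and> e Uv mod e Mv = e Vv mod e Mv then One else l]"
  have 1: "reaches x (residue ;; Cond (Pos Bv) copy (Out One) ;; clear Bv) (h, e(Dv := ?d), y)
      (?d * (100 * e Mv + 100) + 2 * e Mv + 10) (h, e, ?y)" if "?d \<noteq> 0"
  proof -
    have *: "?d mod e Mv = 0 \<longleftrightarrow> e Uv mod e Mv = e Vv mod e Mv"
      using dvd_dist_iff_mod_eq[of "e Mv" "e Uv" "e Vv"] by (simp add: mod_eq_0_iff_dvd)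
    have "reaches x (Cond (Pos Bv) copy (Out One)) (h, e(Dv := 0, Bv := ?d mod e Mv), y) 3
        (h, e(Dv := 0, Bv := ?d mod e Mv), ?y)"
      by (rule reaches_CondI[where T = 2])
        (use that * in \<open>auto intro!: reaches_weaken[OF reaches_copy[OF l]] reaches_weaken[OF reaches_Out]\<close>)
    moreover have "?d mod e Mv \<le> e Mv"
      using m by (simp add: less_imp_le)
    moreover have "reaches x residue (h, e(Dv := ?d), y) (?d * (100 * e Mv + 100) + 1)
        (h, e(Dv := 0, Bv := ?d mod e Mv), y)"
      by (rule reaches_weaken[OF reaches_residue]) (use z m in auto)
    ultimately show ?thesis
      by (intro reaches_weaken[OF reaches_Seq[OF _ reaches_Seq[OF _ reaches_clear]]]) (use z in \<open>auto simp: fun_eq_iff\<close>)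
  qed
  have 2: "reaches x (Cond (Pos Dv) (residue ;; Cond (Pos Bv) copy (Out One) ;; clear Bv) copy)
      (h, e(Dv := ?d), y) (?d * (100 * e Mv + 100) + 2 * e Mv + 11) (h, e, ?y)"
    by (rule reaches_CondI, rule 1) (use z in \<open>auto intro!: reaches_weaken[OF reaches_copy[OF l]] simp: fun_eq_iff\<close>)
  have d: "?d \<le> e Uv + e Vv" by simp
  have "?d * (100 * e Mv + 100) \<le> (e Uv + e Vv) * (100 * e Mv + 100)"
    by (intro mult_le_mono1 d)
  then have 3: "reaches x (Cond (Pos Dv) (residue ;; Cond (Pos Bv) copy (Out One) ;; clear Bv) copy)
      (h, e(Dv := ?d), y) ((e Uv + e Vv) * (100 * e Mv + 100) + 2 * e Mv + 11) (h, e, ?y)"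
    by (intro reaches_weaken[OF 2 refl]) simp
  have [simp]: "e(Av := 0) = e" "e(Dv := d, Av := 0) = e(Dv := d)" for d
    using z by (auto simp: fun_eq_iff)
  show ?thesis
    unfolding emit_large_def
    apply (rule reaches_weaken)
      apply (rule reaches_Seq, (rule reaches_add reaches_sub reaches_clear; (simp add: z; fail)), (simp add: z)?)+
      apply (rule 3)
    apply (rule refl)
    apply (simp add: algebra_simps z)
    done
qed

definition emit :: "counter com" where
  "emit = Cond (Pos Fv) emit_small emit_large"

text \<open>Common specification for the program and for the graphs: \<open>b\<close> selects the
  deletion case, and \<open>l\<close> is the old matrix entry at \<open>(u, v)\<close>.\<close>

definition new_letter :: "bool \<Rightarrow> nat \<Rightarrow> nat \<Rightarrow> nat \<Rightarrow> nat \<Rightarrow> letter \<Rightarrow> letter" where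
  "new_letter b k m u v l =
     (if b then if u < k \<and> v < k then Zero else l
      else if u \<noteq> v \<and> u mod m = v mod m then One else l)"

lemma reaches_emit:
  assumes z: "e Tv = 0" "e Av = 0" "e Bv = 0" "e Dv = 0" and m: "e Fv > 0 \<or> e Mv > 0"
    and l: "contents x h = code l" "l \<noteq> Sep"
    and n: "e Uv \<le> n" "e Vv \<le> n" "e Mv \<le> n" "e Kv \<le> Suc n"
  shows "reaches x emit (h, e, y) (1000 * (n + 1) ^ 2)
     (h, e, y @ [new_letter (e Fv > 0) (e Kv) (e Mv) (e Uv) (e Vv) l])"
proof -
  have n2: "(n + 1)\<^sup>2 \<ge> n + 1"
    by (simp add: power2_eq_square)
  have "(e Uv + e Vv + 1) * (200 * e Mv + 300) \<le> (2 * (n + 1)) * (300 * (n + 1))"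
    using n by (intro mult_le_mono) auto
  also have "\<dots> = 600 * (n + 1)\<^sup>2"
    by (simp add: power2_eq_square algebra_simps)
  finally show ?thesis
    unfolding emit_def
    by (intro reaches_CondI[where T = "600 * (n + 1)\<^sup>2"])
      (use n n2 m in \<open>auto simp: new_letter_def intro!: reaches_weaken[OF reaches_emit_small[OF z(1-3) l]]
         reaches_weaken[OF reaches_emit_large[OF z _ l]]\<close>)
qed

section \<open>Layout of the input string\<close>

definition rows :: "nat \<Rightarrow> (nat \<Rightarrow> nat \<Rightarrow> letter) \<Rightarrow> nat \<Rightarrow> letter list" where
  "rows n L j = concat (map (\<lambda>u. map (L u) [0..<n] @ [Sep]) [0..<j])"

lemma rows_0 [simp]: "rows n L 0 = []"
  by (simp add: rows_def)

lemma rows_Suc: "rows n L (Suc j) = rows n L j @ map (L j) [0..<n] @ [Sep]"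
  by (simp add: rows_def)

text \<open>With its separator a row occupies \<open>Suc n\<close> cells, so entry
  \<open>(u, v)\<close> is found at position \<open>u * Suc n + v\<close>.\<close>

lemma length_rows [simp]: "length (rows n L j) = j * Suc n"
  by (induction j) (simp_all add: rows_Suc)

lemma rows_split: "u < j \<Longrightarrow> \<exists>q. rows n L j = rows n L u @ map (L u) [0..<n] @ Sep # q"
proof (induction j)
  case (Suc j)
  then show ?case
    by (cases "u = j") (auto simp: rows_Suc)
qed simp

lemma contents_append_Cons: "contents (p @ c # q) (int (length p)) = code c"
  by (simp add: contents_def)

lemma contents_nonblank: "contents x h \<in> {1, 2, 3} \<longleftrightarrow> 0 \<le> h \<and> h < int (length x)"
proof -
  have "code a \<in> {1, 2, 3}" for a by (cases a) auto
  then show ?thesis by (auto simp: contents_def)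
qed

lemma holds_nonblank: "holds x (h, e, y) (Read {1, 2, 3}) \<longleftrightarrow> 0 \<le> h \<and> h < int (length x)"
  using contents_nonblank[of x h] by simp

lemma code_letter: "l \<noteq> Sep \<Longrightarrow> code l \<in> {1, 2}"
  by (cases l) auto

lemma enc_nat_nth:
  "j < length (enc_nat k) \<Longrightarrow> enc_nat k ! j = (if odd (k div 2 ^ j) then One else Zero)"
proof (induction j arbitrary: k)
  case 0
  then show ?case by (subst enc_nat.simps) auto
next
  case (Suc j)
  have "k \<noteq> 0" using Suc.prems by (intro notI) simp
  then have "enc_nat k = (if odd k then One else Zero) # enc_nat (k div 2)"
    by (subst enc_nat.simps) simp
  then show ?case
    using Suc.prems Suc.IH[of "k div 2"] by (simp add: div_mult2_eq)
qed

text \<open>Starting point of the Horner scheme: before any bit is read, the value \<open>0\<close>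
  is \<open>k\<close> shifted right by all its bits.\<close>

lemma div_two_power_length_enc_nat: "k div 2 ^ length (enc_nat k) = 0"
proof (induction k rule: less_induct)
  case (less k)
  show ?case
  proof (cases "k = 0")
    case False
    then show ?thesis
      using less[of "k div 2"] unfolding enc_nat.simps[of k]
      by (simp add: div_mult2_eq)
  qed simp
qed

section \<open>Passes over the input\<close>

definition count_vertices :: "counter com" where
  "count_vertices = While (Read {1, 2}) (Inc Nv ;; Move MoveRight)"

definition seek_end :: "counter com" where
  "seek_end = While (Read {1, 2, 3}) (Move MoveRight) ;; Move MoveLeft"

definition read_target :: "counter com" where
  "read_target = While (Read {1, 2}) (digit ;; Move MoveLeft)"

definition rewind :: "counter com" where
  "rewind = While (Read {1, 2, 3}) (Move MoveLeft) ;; Move MoveRight"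

definition emit_row :: "counter com" where
  "emit_row = While (Read {1, 2}) (emit ;; Move MoveRight ;; Inc Vv)"

definition emit_rows :: "counter com" where
  "emit_rows = While (Read {1, 2}) (emit_row ;; Out Sep ;; Move MoveRight ;; clear Vv ;; Inc Uv)"

definition emit_target :: "counter com" where
  "emit_target = Out Sep ;; Move MoveRight ;; While (Read {1, 2}) (copy ;; Move MoveRight) ;; Out Sep"

definition emit_answer :: "counter com" where
  "emit_answer =
     Cond (Pos Fv)
       (Out One ;;
        While (Pos Nv) (Dec Nv ;; Cond (Pos Kv) (Dec Kv ;; Out One) (Out Zero)))
       (Out Zero)"

lemma reaches_emit_answer:
  assumes "e Nv = n" "e Kv = k"
  shows "\<exists>e'. reaches x emit_answer (h, e, y) (10 * n + 10)
     (h, e', y @ (if e Fv > 0 then One # map (\<lambda>v. if v < k then One else Zero) [0..<n] else [Zero]))"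
proof (cases "e Fv > 0")
  case True
  let ?e' = "e(Nv := 0, Kv := k - n)"
  have "reaches x (While (Pos Nv) (Dec Nv ;; Cond (Pos Kv) (Dec Kv ;; Out One) (Out Zero)))
      (h, e, y @ [One]) (n * 7 + 1)
      (h, ?e', y @ [One] @ map (\<lambda>v. if v < k then One else Zero) [0..<n])"
  proof (rule reaches_WhileI[where \<sigma> = "\<lambda>i. (h, e(Nv := n - i, Kv := k - i),
        y @ [One] @ map (\<lambda>v. if v < k then One else Zero) [0..<i])" and n = n and T = 6])
    fix i assume "i < n"
    show "reaches x (Dec Nv ;; Cond (Pos Kv) (Dec Kv ;; Out One) (Out Zero))
      (h, e(Nv := n - i, Kv := k - i), y @ [One] @ map (\<lambda>v. if v < k then One else Zero) [0..<i]) 6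
      (h, e(Nv := n - Suc i, Kv := k - Suc i), y @ [One] @ map (\<lambda>v. if v < k then One else Zero) [0..<Suc i])"
      by (rule reaches_weaken, rule reaches_Seq[OF reaches_Dec],
          rule reaches_CondI[where T = 3 and T' = 4 and s' = "(h, e(Nv := n - Suc i, Kv := k - Suc i),
             y @ [One] @ map (\<lambda>v. if v < k then One else Zero) [0..<Suc i])"])
        (auto intro!: reaches_weaken[OF reaches_Seq[OF reaches_Dec reaches_Out]] reaches_weaken[OF reaches_Out]
          simp: fun_eq_iff)
  qed (use assms in \<open>auto simp: fun_eq_iff\<close>)
  then show ?thesis
    unfolding emit_answer_def using True
    by (intro exI[of _ ?e'] reaches_CondI[where T = "7 * n + 9"])
      (auto intro!: reaches_weaken[OF reaches_Seq[OF reaches_Out]])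
next
  case False
  then show ?thesis
    unfolding emit_answer_def
    by (intro exI[of _ e] reaches_CondI[where T = 1])
      (auto intro!: reaches_weaken[OF reaches_Out])
qed

text \<open>The matrix letters are arbitrary apart from not being separators, so the passes are
  analysed without reference to graphs.\<close>

locale instance_input =
  fixes n k :: nat and L :: "nat \<Rightarrow> nat \<Rightarrow> letter" and x :: "letter list"
  assumes L: "L u v \<noteq> Sep" and x: "x = rows n L n @ Sep # enc_nat k"
begin

lemma contents_entry:
  assumes "u < n" "v < n"
  shows "contents x (int (u * Suc n + v)) = code (L u v)"
proof -
  obtain q where q: "rows n L n = rows n L u @ map (L u) [0..<n] @ Sep # q"
    using rows_split[OF assms(1)] by blast
  have "[0..<n] = [0..<v] @ v # [Suc v..<n]"
    using assms(2) by (metis less_imp_le_nat upt_add_eq_append upt_conv_Cons le_add_diff_inverse zero_le)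
  then have "map (L u) [0..<n] = map (L u) [0..<v] @ L u v # map (L u) [Suc v..<n]"
    by (metis list.simps(9) map_append)
  then have "x = (rows n L u @ map (L u) [0..<v]) @ L u v # (map (L u) [Suc v..<n] @ Sep # q @ Sep # enc_nat k)"
    by (simp add: x q)
  from arg_cong[OF this, of contents] show ?thesis
    using contents_append_Cons[of "rows n L u @ map (L u) [0..<v]" "L u v"] by simp
qed

lemma contents_row_end:
  assumes "u < n"
  shows "contents x (int (u * Suc n + n)) = 3"
proof -
  obtain q where q: "rows n L n = rows n L u @ map (L u) [0..<n] @ Sep # q"
    using rows_split[OF assms(1)] by blast
  then have "x = (rows n L u @ map (L u) [0..<n]) @ Sep # (q @ Sep # enc_nat k)"
    by (simp add: x)
  from arg_cong[OF this, of contents] show ?thesis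
    using contents_append_Cons[of "rows n L u @ map (L u) [0..<n]" Sep] by simp
qed

lemma contents_rows_end: "contents x (int (n * Suc n)) = 3"
  using contents_append_Cons[of "rows n L n" Sep] by (simp add: x)

lemma contents_target:
  assumes "i < length (enc_nat k)"
  shows "contents x (int (n * Suc n + 1 + i)) = code (enc_nat k ! i)"
  using assms unfolding x contents_def by (auto simp: nth_append simp del: of_nat_Suc of_nat_add of_nat_mult)

lemma length_x: "length x = n * Suc n + 1 + length (enc_nat k)"
  by (simp add: x)

text \<open>The number of vertices is the length of the first row. For \<open>n = 0\<close> the scan
  stops at once on the separator in front of \<open>k\<close>.\<close>

lemma reaches_count_vertices:
  "reaches x count_vertices (0, \<lambda>_. 0, y) (4 * n + 1) (int n, (\<lambda>_. 0)(Nv := n), y)"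
  unfolding count_vertices_def
proof (rule reaches_WhileI[where \<sigma> = "\<lambda>i. (int i, (\<lambda>_. 0)(Nv := i), y)" and n = n and T = 3])
  show "holds x (int i, (\<lambda>_. 0)(Nv := i), y) (Read {1, 2})" if "i < n" for i
    using contents_entry[of 0 i] that code_letter[OF L[of 0 i]] by simp
  show "\<not> holds x (int n, (\<lambda>_. 0)(Nv := n), y) (Read {1, 2})"
    using contents_row_end[of 0] contents_rows_end by (cases "n = 0") simp_all
  show "reaches x (Inc Nv ;; Move MoveRight) (int i, (\<lambda>_. 0)(Nv := i), y) 3
      (int (Suc i), (\<lambda>_. 0)(Nv := Suc i), y)" for i
    by (rule reaches_weaken[OF reaches_Seq[OF reaches_Inc reaches_Move]]) auto
qed auto

lemma reaches_seek_end:
  assumes "n \<le> length x"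
  shows "reaches x seek_end (int n, e, y) (2 * length x + 5) (int (length x) - 1, e, y)"
proof -
  have "reaches x (While (Read {1, 2, 3}) (Move MoveRight)) (int n, e, y) (2 * length x + 1)
      (int (length x), e, y)"
    by (rule reaches_WhileI[where \<sigma> = "\<lambda>i. (int (n + i), e, y)" and n = "length x - n" and T = 1])
      (use assms in \<open>auto simp: holds_nonblank[unfolded One_nat_def] simp del: holds.simps intro!: reaches_weaken[OF reaches_Move]\<close>)
  then show ?thesis
    unfolding seek_end_def by (rule reaches_weaken[OF reaches_Seq[OF _ reaches_Move]]) auto
qed

text \<open>The least significant bit comes first in the encoding, so reading leftwards from the end
  meets the leading bit first. After \<open>i\<close> bits the counter holds the capped value of the
  \<open>i\<close> leading bits of \<open>k\<close>.\<close>

lemma reaches_read_target: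
  "reaches x read_target (int (length x) - 1, (\<lambda>_. 0)(Nv := n), y)
     (length x * (200 * n + 300) + 1)
     (int (n * Suc n), (\<lambda>_. 0)(Nv := n, Kv := min k (Suc n)), y)"
proof -
  let ?l = "length (enc_nat k)"
  let ?\<sigma> = "\<lambda>i. (int (n * Suc n + ?l - i), (\<lambda>_. 0)(Nv := n, Kv := min (k div 2 ^ (?l - i)) (Suc n)), y)"
  have at: "contents x (int (n * Suc n + ?l - i)) = (if odd (k div 2 ^ (?l - Suc i)) then 2 else 1)"
    if "i < ?l" for i
  proof -
    have "n * Suc n + ?l - i = n * Suc n + 1 + (?l - Suc i)"
      using that by simp
    then show ?thesis
      using contents_target[of "?l - Suc i"] that by (simp add: enc_nat_nth)
  qed
  have "reaches x read_target (int (length x) - 1, (\<lambda>_. 0)(Nv := n), y) (?l * Suc (200 * n + 299) + 1) (?\<sigma> ?l)"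
    unfolding read_target_def
  proof (rule reaches_WhileI[where \<sigma> = ?\<sigma> and n = ?l and T = "200 * n + 299"])
    show "?\<sigma> 0 = (int (length x) - 1, (\<lambda>_. 0)(Nv := n), y)"
      by (simp add: length_x div_two_power_length_enc_nat fun_eq_iff)
    show "holds x (?\<sigma> i) (Read {1, 2})" if "i < ?l" for i
      using at[OF that] by simp
    show "\<not> holds x (?\<sigma> ?l) (Read {1, 2})"
      using contents_rows_end by simp
    show "reaches x (digit ;; Move MoveLeft) (?\<sigma> i) (200 * n + 299) (?\<sigma> (Suc i))" if i: "i < ?l" for i
    proof -
      define j where "j = ?l - Suc i"
      have j: "?l - i = Suc j" using i by (simp add: j_def)
      define b where "b = (if contents x (int (n * Suc n + ?l - i)) = 2 then 1 else 0 :: nat)"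
      have "k div 2 ^ Suc j = (k div 2 ^ j) div 2"
        by (metis div_mult2_eq power_Suc2)
      moreover have "b = (k div 2 ^ j) mod 2"
        using at[OF i] by (simp add: b_def j_def odd_iff_mod_2_eq_one)
      \<comment> \<open>Capping in every Horner step equals capping once at the end: when
        \<open>a div 2\<close> exceeds \<open>s\<close>, both sides are \<open>s\<close>.\<close>
      moreover have "min (2 * min (a div 2) s + a mod 2) s = min a s" for a s :: nat
        by (cases "a div 2 \<le> s") auto
      ultimately have "min (2 * min (k div 2 ^ Suc j) (Suc n) + b) (Suc n) = min (k div 2 ^ j) (Suc n)"
        by simp
      then show ?thesis
        using i
        by (intro reaches_weaken[OF reaches_Seq[OF reaches_digit[OF _ _ _ b_def] reaches_Move]])
          (auto simp: j j_def fun_eq_iff min_def)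
    qed
  qed auto
  moreover have "?l * Suc (200 * n + 299) \<le> length x * (200 * n + 300)"
    by (intro mult_le_mono) (simp_all add: length_x)
  ultimately show ?thesis
    by - (rule reaches_weaken, assumption, auto)
qed

lemma reaches_rewind:
  "reaches x rewind (int (n * Suc n), e, y) (2 * length x + 5) (0, e, y)"
proof -
  define p where "p = n * Suc n"
  have "p < length x"
    by (simp add: p_def length_x)
  then have "reaches x (While (Read {1, 2, 3}) (Move MoveLeft)) (int p, e, y) (2 * length x + 1) (- 1, e, y)"
    \<comment> \<open>The scan stops on the blank cell \<open>-1\<close> to the left of the input,
      hence \<open>p + 1\<close> rounds and a final move to the right.\<close>
    by (intro reaches_WhileI[where \<sigma> = "\<lambda>i. (int p - int i, e, y)" and n = "p + 1" and T = 1])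
      (auto simp: holds_nonblank[unfolded One_nat_def] simp del: holds.simps intro!: reaches_weaken[OF reaches_Move])
  then show ?thesis
    unfolding rewind_def p_def by (rule reaches_weaken[OF reaches_Seq[OF _ reaches_Move]]) auto
qed

text \<open>Finite \<open>dist_EK\<close> forces the output instance to carry the original
  \<open>k\<close>, so its digits are copied from the input rather than taken from the capped
  counter.\<close>

lemma reaches_emit_target:
  "reaches x emit_target (int (n * Suc n), e, y) (5 * length x + 10)
     (int (length x), e, y @ [Sep] @ enc_nat k @ [Sep])"
proof -
  let ?l = "length (enc_nat k)"
  have "reaches x (While (Read {1, 2}) (copy ;; Move MoveRight)) (int (n * Suc n) + 1, e, y @ [Sep]) (5 * length x + 1)
      (int (length x), e, y @ [Sep] @ enc_nat k)"
  proof (rule reaches_WhileI[where \<sigma> = "\<lambda>i. (int (n * Suc n + 1 + i), e, y @ [Sep] @ take i (enc_nat k))"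
      and n = ?l and T = 4])
    fix i assume i: "i < ?l"
    have ne: "enc_nat k ! i \<noteq> Sep"
      using i by (simp add: enc_nat_nth)
    show "holds x (int (n * Suc n + 1 + i), e, y @ [Sep] @ take i (enc_nat k)) (Read {1, 2})"
      using contents_target[OF i] code_letter[OF ne] by simp
    show "reaches x (copy ;; Move MoveRight) (int (n * Suc n + 1 + i), e, y @ [Sep] @ take i (enc_nat k)) 4
       (int (n * Suc n + 1 + Suc i), e, y @ [Sep] @ take (Suc i) (enc_nat k))"
      by (rule reaches_weaken[OF reaches_Seq[OF reaches_copy[OF contents_target[OF i] ne] reaches_Move]])
        (use i in \<open>auto simp: take_Suc_conv_app_nth\<close>)
  next
    show "\<not> holds x (int (length x), e, y @ [Sep] @ enc_nat k) (Read {1, 2})"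
      by (simp add: contents_def)
  qed (simp_all add: length_x)
  then show ?thesis
    unfolding emit_target_def
    by (intro reaches_weaken[OF reaches_Seq[OF reaches_Out reaches_Seq[OF reaches_Move reaches_Seq[OF _ reaches_Out]]]]) auto
qed

end

context instance_input
begin

lemma reaches_emit_row:
  assumes z: "e Tv = 0" "e Av = 0" "e Bv = 0" "e Dv = 0" "e Vv = 0"
    and m: "e Fv > 0 \<or> e Mv > 0"
    and n: "e Mv \<le> n" "e Kv \<le> Suc n" and u: "e Uv = u" "u < n"
  shows "reaches x emit_row (int (u * Suc n), e, y) (n * (1000 * (n + 1)\<^sup>2 + 5) + 1)
     (int (u * Suc n + n), e(Vv := n), y @ map (\<lambda>v. new_letter (e Fv > 0) (e Kv) (e Mv) u v (L u v)) [0..<n])"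
  unfolding emit_row_def
proof (rule reaches_WhileI[where n = n and T = "1000 * (n + 1)\<^sup>2 + 4" and
      \<sigma> = "\<lambda>v. (int (u * Suc n + v), e(Vv := v),
        y @ map (\<lambda>v. new_letter (e Fv > 0) (e Kv) (e Mv) u v (L u v)) [0..<v])"])
  fix v assume v: "v < n"
  let ?y = "y @ map (\<lambda>v. new_letter (e Fv > 0) (e Kv) (e Mv) u v (L u v)) [0..<v]"
  note c = contents_entry[OF u(2) v]
  show "holds x (int (u * Suc n + v), e(Vv := v), ?y) (Read {1, 2})"
    using c code_letter[OF L[of u v]] by simp
  have "reaches x emit (int (u * Suc n + v), e(Vv := v), ?y) (1000 * (n + 1)\<^sup>2)
      (int (u * Suc n + v), e(Vv := v), ?y @ [new_letter (e Fv > 0) (e Kv) (e Mv) u v (L u v)])"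
    by (rule reaches_weaken[OF reaches_emit[OF _ _ _ _ _ c L, where n = n]]) (use assms v in auto)
  then show "reaches x (emit ;; Move MoveRight ;; Inc Vv) (int (u * Suc n + v), e(Vv := v), ?y)
      (1000 * (n + 1)\<^sup>2 + 4)
      (int (u * Suc n + Suc v), e(Vv := Suc v),
        y @ map (\<lambda>v. new_letter (e Fv > 0) (e Kv) (e Mv) u v (L u v)) [0..<Suc v])"
    by (rule reaches_weaken[OF reaches_Seq[OF _ reaches_Seq[OF reaches_Move reaches_Inc]]]) auto
next
  show "\<not> holds x (int (u * Suc n + n), e(Vv := n),
      y @ map (\<lambda>v. new_letter (e Fv > 0) (e Kv) (e Mv) u v (L u v)) [0..<n]) (Read {1, 2})"
    using contents_row_end[OF u(2)] by simp
qed (use z in \<open>auto simp: fun_eq_iff\<close>)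

text \<open>The loop test inspects the cell where the next row would begin. It shows a matrix letter
  if a row follows, since then \<open>n > 0\<close>, and the separator in front of \<open>k\<close>
  otherwise.\<close>

lemma reaches_emit_rows:
  assumes z: "e Tv = 0" "e Av = 0" "e Bv = 0" "e Dv = 0" "e Vv = 0" "e Uv = 0"
    and m: "n > 0 \<Longrightarrow> e Fv > 0 \<or> e Mv > 0"
    and n: "e Mv \<le> n" "e Kv \<le> Suc n"
  shows "reaches x emit_rows (0, e, []) (n * (n * (1000 * (n + 1)\<^sup>2 + 7) + 10) + 1)
     (int (n * Suc n), e(Uv := n), rows n (\<lambda>u v. new_letter (e Fv > 0) (e Kv) (e Mv) u v (L u v)) n)"
  unfolding emit_rows_def
proof (rule reaches_WhileI[where n = n and T = "n * (1000 * (n + 1)\<^sup>2 + 7) + 9" and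
      \<sigma> = "\<lambda>u. (int (u * Suc n), e(Uv := u),
        rows n (\<lambda>u v. new_letter (e Fv > 0) (e Kv) (e Mv) u v (L u v)) u)"])
  let ?L = "\<lambda>u v. new_letter (e Fv > 0) (e Kv) (e Mv) u v (L u v)"
  fix u assume u: "u < n"
  show "holds x (int (u * Suc n), e(Uv := u), rows n ?L u) (Read {1, 2})"
    using contents_entry[of u 0] u code_letter[OF L[of u 0]] by simp
  have "reaches x emit_row (int (u * Suc n), e(Uv := u), rows n ?L u) (n * (1000 * (n + 1)\<^sup>2 + 5) + 1)
      (int (u * Suc n + n), e(Uv := u, Vv := n), rows n ?L u @ map (?L u) [0..<n])"
    by (rule reaches_weaken[OF reaches_emit_row]) (use assms u in auto)
  then show "reaches x (emit_row ;; Out Sep ;; Move MoveRight ;; clear Vv ;; Inc Uv)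
      (int (u * Suc n), e(Uv := u), rows n ?L u) (n * (1000 * (n + 1)\<^sup>2 + 7) + 9)
      (int (Suc u * Suc n), e(Uv := Suc u), rows n ?L (Suc u))"
    by (rule reaches_weaken[OF reaches_Seq[OF _ reaches_Seq[OF reaches_Out reaches_Seq[OF reaches_Move
            reaches_Seq[OF reaches_clear reaches_Inc]]]]])
      (use z in \<open>auto simp: rows_Suc fun_eq_iff algebra_simps\<close>)
next
  show "\<not> holds x (int (n * Suc n), e(Uv := n),
      rows n (\<lambda>u v. new_letter (e Fv > 0) (e Kv) (e Mv) u v (L u v)) n) (Read {1, 2})"
    using contents_rows_end by simp
qed (use z in \<open>auto simp: fun_eq_iff\<close>)

end

section \<open>The complete program and its running time\<close>

definition solver :: "counter com" where
  "solver = count_vertices ;; seek_end ;; read_target ;; decide ;; rewind ;; emit_rows ;; emit_target ;; emit_answer"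

text \<open>Assumption \<open>m\<close> makes the modulus \<open>K - 1\<close> positive whenever
  residues have to be computed.\<close>

lemma (in instance_input) reaches_solver:
  fixes K :: nat
  defines "K \<equiv> min k (Suc n)"
  defines "b \<equiv> decision n K > 0"
  assumes m: "n > 0 \<Longrightarrow> b \<or> K > 1"
  shows "\<exists>h e. reaches x solver (0, \<lambda>_. 0, []) (10000 * (length x + 1) ^ 4)
     (h, e, rows n (\<lambda>u v. new_letter b K (K - 1) u v (L u v)) n @ Sep # enc_nat k @ Sep #
        (if b then One # map (\<lambda>v. if v < K then One else Zero) [0..<n] else [Zero]))"
proof -
  let ?e = "(\<lambda>_. 0)(Nv := n, Kv := K, Mv := K - 1, Fv := decision n K)"
  let ?y = "rows n (\<lambda>u v. new_letter b K (K - 1) u v (L u v)) n"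
  have K_le: "K \<le> Suc n" by (simp add: K_def)
  have n_le: "n \<le> length x" by (simp add: length_x)
  have rows: "reaches x emit_rows (0, ?e, []) (n * (n * (1000 * (n + 1)\<^sup>2 + 7) + 10) + 1)
     (int (n * Suc n), ?e(Uv := n), ?y)"
    by (rule reaches_weaken[OF reaches_emit_rows]) (use m in \<open>auto simp: b_def K_def\<close>)
  obtain e' where ans: "reaches x emit_answer (int (length x), ?e(Uv := n), ?y @ [Sep] @ enc_nat k @ [Sep]) (10 * n + 10)
     (int (length x), e', (?y @ [Sep] @ enc_nat k @ [Sep]) @ (if b then One # map (\<lambda>v. if v < K then One else Zero) [0..<n] else [Zero]))"
    using reaches_emit_answer[of "?e(Uv := n)" n K x "int (length x)" "?y @ [Sep] @ enc_nat k @ [Sep]"]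
    by (auto simp: b_def)
  define s where "s = length x + 1"
  have s: "n + 1 \<le> s" "length x \<le> s" "1 \<le> s" using n_le by (simp_all add: s_def)
  \<comment> \<open>Degree four stems from the at most quadratic number of matrix entries, each at
    quadratic cost; all other passes have lower degree.\<close>
  have time: "4 * n + 1 + (2 * length x + 5) + (length x * (200 * n + 300) + 1) + 1000 * (n + 1) ^ 3 +
      (2 * length x + 5) + (n * (n * (1000 * (n + 1)\<^sup>2 + 7) + 10) + 1) + (5 * length x + 10) + (10 * n + 10) + 10
      \<le> 10000 * s ^ 4"
  proof -
    have "n * (n * (1000 * (n + 1)\<^sup>2 + 7) + 10) \<le> s * (s * (1000 * s\<^sup>2 + 7) + 10)"
      using s by (intro mult_le_mono add_le_mono power_mono) auto
    moreover have "1000 * (n + 1) ^ 3 \<le> 1000 * s ^ 3"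
      using s by (intro mult_le_mono power_mono) auto
    moreover have "length x * (200 * n + 300) \<le> s * (200 * s + 300)"
      using s by (intro mult_le_mono add_le_mono) auto
    moreover have "s \<le> s ^ 4" "s\<^sup>2 \<le> s ^ 4" "s ^ 3 \<le> s ^ 4" "1 \<le> s ^ 4"
      using s(3) power_increasing[of 1 4 s] by (auto intro!: power_increasing)
    moreover have "s * (s * (1000 * s\<^sup>2 + 7) + 10) = 1000 * s ^ 4 + 7 * s\<^sup>2 + 10 * s"
      "s * (200 * s + 300) = 200 * s\<^sup>2 + 300 * s"
      by (simp_all add: algebra_simps power2_eq_square power4_eq_xxxx)
    ultimately show ?thesis
      using s(1,2) by linarith
  qed
  have "reaches x solver (0, \<lambda>_. 0, []) (10000 * s ^ 4)
     (int (length x), e', (?y @ [Sep] @ enc_nat k @ [Sep]) @ (if b then One # map (\<lambda>v. if v < K then One else Zero) [0..<n] else [Zero]))"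
    unfolding solver_def
    by (rule reaches_weaken[OF reaches_Seq[OF reaches_count_vertices
          reaches_Seq[OF reaches_seek_end[OF n_le]
          reaches_Seq[OF reaches_read_target[folded K_def]
          reaches_Seq[OF reaches_decide[OF K_le]
          reaches_Seq[OF reaches_rewind
          reaches_Seq[OF rows
          reaches_Seq[OF reaches_emit_target ans]]]]]]] refl])
      (use time in simp)
  then show ?thesis
    by (intro exI[of _ "int (length x)"] exI[of _ e']) (simp add: s_def)
qed

section \<open>The modified graphs\<close>

text \<open>Raise the assumption to the power \<open>2 / 3\<close>.\<close>

lemma cube_le_square_imp:
  fixes m n :: nat
  assumes "m ^ 3 \<le> n ^ 2"
  shows "real (m ^ 2) \<le> real n powr (4 / 3)"
proof (cases "m = 0")
  case False
  then have "n \<noteq> 0" using assms by (auto intro!: Nat.gr0I)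
  have "real m ^ 3 \<le> real n ^ 2"
    using assms by (metis of_nat_le_iff of_nat_power)
  then have "(real m ^ 3) powr (2 / 3) \<le> (real n ^ 2) powr (2 / 3)"
    by (intro powr_mono2) auto
  moreover have "real m ^ 3 = real m powr 3" "real n ^ 2 = real n powr 2"
    using False \<open>n \<noteq> 0\<close> by (simp_all add: powr_numeral)
  ultimately have "real m powr 2 \<le> real n powr (4 / 3)"
    by (simp only: powr_powr) simp
  then show ?thesis
    using False by (simp add: powr_numeral)
qed simp

text \<open>The cube root of the assumption bounds \<open>m\<close> below by
  \<open>n powr (2 / 3)\<close>, and dividing \<open>n * n\<close> by this leaves the exponent
  \<open>4 / 3\<close>.\<close>

lemma square_le_cube_imp:
  fixes m n :: nat
  assumes "n ^ 2 \<le> m ^ 3"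
  shows "real (n * (n div m)) \<le> real n powr (4 / 3)"
proof (cases "n = 0")
  case False
  then have m: "m \<noteq> 0" using assms by (auto intro!: Nat.gr0I)
  have "real n ^ 2 \<le> real m ^ 3"
    using assms by (metis of_nat_le_iff of_nat_power)
  then have "(real n ^ 2) powr (1 / 3) \<le> (real m ^ 3) powr (1 / 3)"
    by (intro powr_mono2) auto
  moreover have "real m ^ 3 = real m powr 3" "real n ^ 2 = real n powr 2"
    using False m by (simp_all add: powr_numeral)
  ultimately have le: "real n powr (2 / 3) \<le> real m"
    by (simp only: powr_powr) (use m in simp)
  have "real n * real n = real n powr (4 / 3) * real n powr (2 / 3)"
    using False by (simp flip: powr_add add: powr_numeral power2_eq_square)
  also have "\<dots> \<le> real n powr (4 / 3) * real m"
    by (intro mult_left_mono le) simp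
  finally have "real n * real n / real m \<le> real n powr (4 / 3)"
    using m by (simp add: divide_le_eq)
  moreover have "real n * real (n div m) \<le> real n * (real n / real m)"
    by (intro mult_left_mono) (simp_all add: of_nat_div_le_of_nat)
  ultimately show ?thesis by simp
qed simp

text \<open>For \<open>k \<ge> 2\<close> one has \<open>k \<le> 2 * (k - 1)\<close>, which absorbs
  the factor \<open>1 / 2\<close>.\<close>

lemma choose_two_le: "k choose 2 \<le> (k - 1) ^ 2"
proof (cases "k \<le> 1")
  case False
  then have "k * (k - 1) \<le> (2 * (k - 1)) * (k - 1)" by (intro mult_le_mono) auto
  from div_le_mono[OF this, of 2] show ?thesis by (simp add: choose_two power2_eq_square mult.assoc)
qed (auto simp: le_Suc_eq numeral_2_eq_2)

section \<open>Deleting inner edges, adding cliques, and the resulting distances\<close>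

definition isolate :: "nat \<Rightarrow> nat ugraph \<Rightarrow> nat ugraph" where
  "isolate k G = \<lparr>verts = verts G, edges = edges G - Pow {..<k}\<rparr>"

definition class_edges :: "nat \<Rightarrow> nat \<Rightarrow> nat set set" where
  "class_edges n m = {{u, v} | u v. u < n \<and> v < n \<and> u \<noteq> v \<and> u mod m = v mod m}"

definition add_cliques :: "nat \<Rightarrow> nat ugraph \<Rightarrow> nat ugraph" where
  "add_cliques m G = \<lparr>verts = verts G, edges = edges G \<union> class_edges (card (verts G)) m\<rparr>"

text \<open>Each edge is charged to its larger endpoint \<open>v\<close>. The smaller one is
  \<open>v - m * Suc j\<close> with \<open>j < n div m\<close>, so pairs \<open>(v, j)\<close> cover
  all edges; pairs yielding no edge do no harm to an upper bound.\<close>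

lemma card_class_edges: "card (class_edges n m) \<le> n * (n div m)"
proof -
  let ?f = "\<lambda>(v, j). {v, v - m * Suc j}"
  have offset: "\<exists>j < n div m. u = v - m * Suc j" if "u < v" "v < n" "u mod m = v mod m" for u v
  proof -
    have "m dvd v - u"
      using that mod_eq_dvd_iff_nat[of u v m] by simp
    then obtain i where i: "v - u = m * i" by blast
    with \<open>u < v\<close> have "i \<noteq> 0" "m \<noteq> 0" by (auto intro!: Nat.gr0I)
    then obtain j where j: "i = Suc j" by (cases i) auto
    have "m * i \<le> n" using i that by linarith
    then have "i \<le> n div m"
      using \<open>m \<noteq> 0\<close> by (simp add: less_eq_div_iff_mult_less_eq mult.commute)
    then show ?thesis using i j that by (intro exI[of _ j]) auto
  qed
  have image: "{u, v} \<in> ?f ` ({..<n} \<times> {..<n div m})" if uv: "u < v" "v < n" "u mod m = v mod m" for u v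
  proof -
    obtain j where "j < n div m" "u = v - m * Suc j"
      using offset[OF uv] by blast
    then show ?thesis
      using uv by (intro image_eqI[of _ _ "(v, j)"]) auto
  qed
  have "class_edges n m \<subseteq> ?f ` ({..<n} \<times> {..<n div m})"
    unfolding class_edges_def
  proof clarify
    fix u v assume uv: "u < n" "v < n" "u \<noteq> v" "u mod m = v mod m"
    show "{u, v} \<in> ?f ` ({..<n} \<times> {..<n div m})"
    proof (cases "u < v")
      case True
      then show ?thesis using image uv by blast
    next
      case False
      then have "{v, u} \<in> ?f ` ({..<n} \<times> {..<n div m})"
        using uv by (intro image) auto
      then show ?thesis by (simp only: insert_commute)
    qed
  qed
  then have "card (class_edges n m) \<le> card ({..<n} \<times> {..<n div m})"
    by (meson card_image_le card_mono finite_SigmaI finite_imageI finite_lessThan order_trans)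
  then show ?thesis by simp
qed

lemma simple_isolate: "simple_graph G \<Longrightarrow> simple_graph (isolate k G)"
  by (auto simp: simple_graph_def isolate_def)

lemma simple_add_cliques:
  assumes "simple_graph G" "verts G = {..<n}" shows "simple_graph (add_cliques m G)"
  using assms by (auto simp: simple_graph_def add_cliques_def class_edges_def)

lemma dist_isolate:
  assumes "simple_graph G" "(k - 1) ^ 3 \<le> n ^ 2"
  shows "dist_E G (isolate k G) \<le> ennreal (real n powr (4 / 3))"
proof -
  let ?D = "(edges G - edges (isolate k G)) \<union> (edges (isolate k G) - edges G)"
  have "?D \<subseteq> {e. e \<subseteq> {..<k} \<and> card e = 2}"
    using assms(1) by (auto simp: isolate_def simple_graph_def)
  then have "card ?D \<le> card {e. e \<subseteq> {..<k} \<and> card e = 2}"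
    by (intro card_mono) auto
  also have "\<dots> \<le> (k - 1) ^ 2"
    using choose_two_le[of k] by (simp add: n_subsets)
  finally have "real (card ?D) \<le> real n powr (4 / 3)"
    using cube_le_square_imp[OF assms(2)] by (meson of_nat_le_iff order_trans)
  then show ?thesis
    by (simp add: dist_E_def isolate_def ennreal_of_nat_eq_real_of_nat)
qed

lemma dist_add_cliques:
  assumes "verts G = {..<n}" "n ^ 2 \<le> m ^ 3"
  shows "dist_E G (add_cliques m G) \<le> ennreal (real n powr (4 / 3))"
proof -
  let ?D = "(edges G - edges (add_cliques m G)) \<union> (edges (add_cliques m G) - edges G)"
  have "class_edges n m \<subseteq> Pow {..<n}"
    by (auto simp: class_edges_def)
  then have "finite (class_edges n m)"
    by (rule finite_subset) simp
  then have "card ?D \<le> card (class_edges n m)"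
    using assms by (intro card_mono) (auto simp: add_cliques_def)
  also note card_class_edges
  finally have "real (card ?D) \<le> real n powr (4 / 3)"
    using square_le_cube_imp[OF assms(2)] by (meson of_nat_le_iff order_trans)
  then show ?thesis
    by (simp add: dist_E_def add_cliques_def ennreal_of_nat_eq_real_of_nat)
qed

lemma independent_isolate:
  "simple_graph G \<Longrightarrow> {..<k} \<subseteq> verts G \<Longrightarrow> independent (isolate k G) {..<k}"
  by (auto simp: independent_def isolate_def)

text \<open>Two members of \<open>S\<close> with the same residue would be joined by a clique edge,
  so reduction modulo \<open>m\<close> embeds \<open>S\<close> into \<open>{..<m}\<close>.\<close>

lemma independent_add_cliques_card:
  assumes "verts G = {..<n}" "independent (add_cliques m G) S" "n > 0 \<Longrightarrow> m > 0"
  shows "card S \<le> m"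
proof (cases "n = 0")
  case False
  have "inj_on (\<lambda>u. u mod m) S"
  proof (rule inj_onI, rule ccontr)
    fix u v assume uv: "u \<in> S" "v \<in> S" "u mod m = v mod m" "u \<noteq> v"
    then have "{u, v} \<in> class_edges n m"
      using assms by (auto simp: class_edges_def independent_def add_cliques_def)
    then show False
      using uv assms by (auto simp: independent_def add_cliques_def)
  qed
  then have "card S \<le> card {..<m}"
    using assms(3) False by (intro card_inj_on_le) auto
  then show ?thesis by simp
qed (use assms in \<open>auto simp: independent_def add_cliques_def\<close>)

section \<open>Encodings of the modified graphs and the final assembly\<close>

definition adjacency :: "nat ugraph \<Rightarrow> nat \<Rightarrow> nat \<Rightarrow> letter" where
  "adjacency G u v = (if {u, v} \<in> edges G then One else Zero)"

lemma enc_graph_rows: "verts G = {..<n} \<Longrightarrow> enc_graph G = rows n (adjacency G) n"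
  by (simp add: enc_graph_def rows_def enc_vset_def adjacency_def[abs_def])

lemma rows_cong:
  assumes "\<And>u v. u < n \<Longrightarrow> v < n \<Longrightarrow> L u v = L' u v"
  shows "rows n L n = rows n L' n"
  unfolding rows_def by (intro arg_cong[of _ _ concat] map_cong refl) (use assms in auto)

lemma enc_isolate:
  assumes "verts G = {..<n}"
  shows "enc_graph (isolate k G) = rows n (\<lambda>u v. new_letter True k m u v (adjacency G u v)) n"
  by (subst enc_graph_rows, simp add: isolate_def assms, rule rows_cong)
    (auto simp: adjacency_def new_letter_def isolate_def)

lemma enc_add_cliques:
  assumes "verts G = {..<n}"
  shows "enc_graph (add_cliques m G) = rows n (\<lambda>u v. new_letter False k m u v (adjacency G u v)) n"
  by (subst enc_graph_rows, simp add: add_cliques_def assms, rule rows_cong)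
    (auto simp: adjacency_def new_letter_def add_cliques_def class_edges_def assms doubleton_eq_iff)

lemma instance_independent_set:
  "(G, k) \<in> instances independent_set_problem \<longleftrightarrow> simple_graph G \<and> (\<exists>n. verts G = {..<n})"
  by (simp add: independent_set_problem_def search_problem_def)

lemma Some_correct_independent_set:
  "independent G S \<Longrightarrow> card S = k \<Longrightarrow> Some S \<in> correct independent_set_problem (G, k)"
  by (auto simp: independent_set_problem_def search_problem_def)

lemma None_correct_independent_set:
  "(\<And>S. independent G S \<Longrightarrow> card S \<noteq> k) \<Longrightarrow> None \<in> correct independent_set_problem (G, k)"
  by (auto simp: independent_set_problem_def search_problem_def)

theorem theorem14:
  shows "Rel vertex_count independent_set_problem dist_EK (\<lambda>n. ennreal (real n powr (4 / 3)))
           \<in> FP enc_instance enc_output"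
proof -
  let ?R = "Rel vertex_count independent_set_problem dist_EK (\<lambda>n. ennreal (real n powr (4 / 3)))"
  obtain M where tm: "turing_machine M"
    and M: "\<And>x T h e y. reaches x solver (0, \<lambda>_. 0, []) T (h, e, y) \<Longrightarrow> outputs_within M x y (Suc T)"
    using outputs_within_com[of solver] by blast
  \<comment> \<open>The time bound of \<open>solver\<close> plus the start-up step of the
    machine.\<close>
  define p :: "nat poly" where "p = smult 10000 ([:1, 1:] ^ 4) + 1"
  have p: "poly p l = Suc (10000 * (l + 1) ^ 4)" for l
    by (simp add: p_def)
  have "\<exists>a \<in> correct ?R I. outputs_within M (enc_instance I) (enc_output a) (poly p (length (enc_instance I)))"
    if I_inst: "I \<in> instances ?R" for I
  proof -
    obtain G k n where I: "I = (G, k)" and G: "simple_graph G" "verts G = {..<n}"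
      using I_inst by (cases I) (auto simp: Rel_def instance_independent_set)
    define x where "x = enc_instance I"
    interpret instance_input n k "adjacency G" x
      by unfold_locales (auto simp: x_def I enc_instance_def enc_graph_rows[OF G(2)] adjacency_def)
    define K where "K = min k (Suc n)"
    define b where "b \<longleftrightarrow> decision n K > 0"
    have small: "K = k \<and> k \<le> n \<and> (k - 1) ^ 3 \<le> n ^ 2" if b
    proof (cases "K = 0")
      case True
      then show ?thesis by (auto simp: K_def min_def split: if_splits)
    next
      case False
      then have lt: "(K - 1) ^ 3 < n ^ 2"
        using that by (simp add: b_def decision_def power2_eq_square power3_eq_cube mult.assoc)
      \<comment> \<open>If the cap were attained, then \<open>K - 1 = n\<close> and
        \<open>lt\<close> would give \<open>n ^ 3 < n ^ 2\<close>. So the deletion case sees the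
        true \<open>k\<close>, and \<open>{..<k}\<close> fits into the vertex set.\<close>
      have "n ^ 2 \<le> n ^ 3"
        by (cases "n = 0") (auto intro!: power_increasing)
      with lt have "K \<noteq> Suc n" by auto
      then have "K = k" "k \<le> n" by (auto simp: K_def min_def split: if_splits)
      with lt show ?thesis by simp
    qed
    have large: "K > 0 \<and> n ^ 2 \<le> (K - 1) ^ 3" if "\<not> b"
      using that by (auto simp: b_def decision_def power2_eq_square power3_eq_cube mult.assoc split: if_splits)
    have pos: "K - 1 > 0" if "\<not> b" "n > 0"
    proof (rule ccontr)
      assume "\<not> K - 1 > 0"
      then have "n ^ 2 \<le> 0" using large[OF that(1)] by simp
      then show False using that(2) by simp
    qed
    define J where "J = (if b then isolate K G else add_cliques (K - 1) G)"
    define a where "a = (if b then Some {..<k} else None)"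
    have J_verts: "verts J = {..<n}"
      using G by (simp add: J_def isolate_def add_cliques_def)
    have "simple_graph J"
      using G by (simp add: J_def simple_isolate simple_add_cliques)
    moreover have "dist_EK (G, k) (J, k) \<le> ennreal (real (vertex_count (G, k)) powr (4 / 3))"
      using dist_isolate[OF G(1), of K n] dist_add_cliques[OF G(2), of "K - 1"] small large G
      by (auto simp: dist_EK_def J_def vertex_count_def)
    moreover have "a \<in> correct independent_set_problem (J, k)"
    proof (cases b)
      case True
      then have "independent (isolate K G) {..<k}"
        using small G independent_isolate[of G k] by auto
      then show ?thesis
        using True by (simp add: a_def J_def Some_correct_independent_set)
    next
      case False
      \<comment> \<open>Here \<open>card S \<le> K - 1 < K \<le> k\<close>, also when the cap is
        active.\<close>
      have "card S \<noteq> k" if "independent (add_cliques (K - 1) G) S" for S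
        using independent_add_cliques_card[OF G(2) that] pos[OF False] large[OF False]
        by (auto simp: K_def)
      then show ?thesis
        using False by (simp add: a_def J_def None_correct_independent_set)
    qed
    ultimately have correct: "((J, k), a) \<in> correct ?R I"
      using J_verts by (auto simp: Rel_def I instance_independent_set)
    have "enc_graph J = rows n (\<lambda>u v. new_letter b K (K - 1) u v (adjacency G u v)) n"
      using enc_isolate[OF G(2)] enc_add_cliques[OF G(2)] by (simp add: J_def)
    \<comment> \<open>The program prints the answer from \<open>K\<close>, whereas \<open>a\<close>
      is stated with \<open>k\<close>; by \<open>small\<close> they agree whenever \<open>b\<close>
      holds.\<close>
    then have out: "enc_output ((J, k), a) =
       rows n (\<lambda>u v. new_letter b K (K - 1) u v (adjacency G u v)) n @ Sep # enc_nat k @ Sep #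
        (if b then One # map (\<lambda>v. if v < K then One else Zero) [0..<n] else [Zero])"
      using J_verts small
      by (auto simp: enc_output_def enc_instance_def a_def vertex_count_def enc_vset_def)
    have "\<exists>h e. reaches x solver (0, \<lambda>_. 0, []) (10000 * (length x + 1) ^ 4) (h, e, enc_output ((J, k), a))"
      unfolding out b_def K_def
      by (rule reaches_solver) (use pos in \<open>auto simp: b_def K_def\<close>)
    then have "outputs_within M x (enc_output ((J, k), a)) (poly p (length x))"
      using M unfolding p by blast
    with correct show ?thesis
      unfolding x_def by blast
  qed
  with tm show ?thesis
    unfolding FP_def by blast
qed

end
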